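(* Let $T\in\mathcal{K}(V)$ be bisectorial of angle $\omega\in(0,\frac{\pi}{2})$, let $\theta\in(\omega,\frac{\pi}{2})$, $f\in\mathcal{SH}_L^0(D_\theta)$, and let $p$ be an intrinsic polynomial of degree $m\in\mathbb{N}_0$. If $pf\in\mathcal{SH}_L^0(D_\theta)$, then $\operatorname{ran}(f(T))\subseteq\operatorname{dom}(T^m)$ and $$(pf)(T)=p[T]f(T),$$ where $f(T)$ and $(pf)(T)$ are given by the $\omega$-functional calculus.
   Context: Clifford setting. Fix an integer $n\geq 1$. $\mathbb{R}_n$ is the real Clifford algebra generated by $e_1,\dots,e_n$ with $e_i^2=-1$, $e_ie_j=-e_je_i$ ($i\neq j$), with basis $e_A=e_{i_1}\cdots e_{i_r}$ for $A=(i_1<\dots<i_r)$, $e_\emptyset=1$, and $|s|^2=\sum_As_A^2$ for $s=\sum_As_Ae_A$. Paravectors: $\mathbb{R}^{n+1}=\{s_0+s_1e_1+\dots+s_ne_n\}\subseteq\mathbb{R}_n$ with $\overline{s}=s_0-s_1e_1-\dots-s_ne_n$. $\mathbb{S}=\{s\in\mathbb{R}^{n+1}: s_0=0,|s|=1\}$ and $\mathbb{C}_J=\{x+Jy: x,y\in\mathbb{R}\}$ for $J\in\mathbb{S}$. $U\subseteq\mathbb{R}^{n+1}$ is axially symmetric if $x+Jy\in U$ ($x,y\in\mathbb{R}$, $J\in\mathbb{S}$) implies $x+Iy\in U$ for all $I\in\mathbb{S}$. Slice hyperholomorphic functions. For $U$ open and axially symmetric, $f:U\to\mathbb{R}_n$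 is left slice hyperholomorphic ($f\in\mathcal{SH}_L(U)$) if there are continuously differentiable $f_0,f_1:\{(x,y)\in\mathbb{R}^2: x+\mathbb{S}y\subseteq U\}\to\mathbb{R}_n$ with $f(x+Jy)=f_0(x,y)+Jf_1(x,y)$ for all $J\in\mathbb{S}$, $f_0(x,-y)=f_0(x,y)$, $f_1(x,-y)=-f_1(x,y)$, $\partial_xf_0=\partial_yf_1$, $\partial_yf_0=-\partial_xf_1$. Operators. $V_\mathbb{R}$ is a real Banach space, $V=\{\sum_Av_A\otimes e_A: v_A\in V_\mathbb{R}\}$ the corresponding Clifford module with norm $\|v\|^2=\sum_A\|v_A\|^2$ and the natural left and right multiplications by $\mathbb{R}_n$. $\mathcal{B}(V)$: bounded everywhere defined right-linear operators; $\mathcal{K}(V)$: closed right-linear operators $T:\operatorname{dom}(T)\to V$ with right-linear domain $\operatorname{dom}(T)\subseteq V$. A Clifford number $a$ is identified with the operator $v\mapsto av$, so $(aT)v=a(Tv)$, $(Ta)v=T(av)$. For $s\in\mathbb{R}^{n+1}$, $Q_s[T]=T^2-2s_0T+|s|^2$ on $\operatorname{dom}(T^2)$; $\rho_S(T)=\{s\in\mathbb{R}^{n+1}: Q_s[T]^{-1}\in\mathcal{B}(V)\}$, $\sigma_S(T)=\mathbb{R}^{n+1}\setminus\rho_S(T)$, and $S_L^{-1}(s,T)=Q_s[T]^{-1}\overline{s}-TQ_s[T]^{-1}$ for $s\in\rho_S(T)$. Bisectorial operators. For $\omega\in(0,\frac{\pi}{2})$, $I_\omega=(-\omega,\omega)\cup(\pi-\omega,\pi+\omega)$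 and $D_\omega=\{re^{J\phi}: r>0,\,J\in\mathbb{S},\,\phi\in I_\omega\}\subseteq\mathbb{R}^{n+1}$. $T\in\mathcal{K}(V)$ is bisectorial of angle $\omega$ if $\sigma_S(T)\subseteq\overline{D_\omega}$ and for every $\varphi\in(\omega,\frac{\pi}{2})$ there is $C_\varphi\geq 0$ with $\|S_L^{-1}(s,T)\|\leq\frac{C_\varphi}{|s|}$ for all $s\in\mathbb{R}^{n+1}\setminus(D_\varphi\cup\{0\})$. $\omega$-functional calculus. $\mathcal{SH}_L^0(D_\theta)$ is the set of bounded $f\in\mathcal{SH}_L(D_\theta)$ with $\int_0^\infty|f(te^{J\phi})|\frac{dt}{t}<\infty$ for all $J\in\mathbb{S}$, $\phi\in I_\theta$. For $T$ bisectorial of angle $\omega$, $\theta\in(\omega,\frac{\pi}{2})$ and $f\in\mathcal{SH}_L^0(D_\theta)$, $$f(T)=\frac{1}{2\pi}\int_{\partial D_\varphi\cap\mathbb{C}_J}S_L^{-1}(s,T)ds_Jf(s):=\frac{1}{2\pi}\sum_\pm\int_\mathbb{R}S_L^{-1}(\gamma_\pm(t),T)\frac{\gamma_\pm'(t)}{J}f(\gamma_\pm(t))dt\in\mathcal{B}(V),$$ with $\gamma_\pm(t)=\pm|t|e^{-\operatorname{sgn}(t)J\varphi}$; it does not depend on the choice of $\varphi\in(\omega,\theta)$ and $J\in\mathbb{S}$. Polynomials. An intrinsic polynomial of degree $m$ is $p(s)=p_0+p_1s+\dots+p_ms^m$ with real coefficients, $p_m\neq 0$; $p[T]=p_0+p_1T+\dots+p_mT^m$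 with $\operatorname{dom}(p[T])=\operatorname{dom}(T^m)$. *)

theory Defs
  imports "HOL-Analysis.Analysis"
begin

text \<open>
  The generators \<open>e\<^sub>i\<close> are indexed by a finite linearly ordered type \<^typ>\<open>'n\<close>, so \<open>n = CARD('n) \<ge> 1\<close>,
  and the basis elements \<open>e\<^sub>A\<close> by the subsets \<open>A\<close> of \<^typ>\<open>'n\<close>.  The relations \<open>e\<^sub>i e\<^sub>j = - e\<^sub>j e\<^sub>i\<close>
  (one sign for each pair \<open>a \<in> A\<close>, \<open>b \<in> B\<close> with \<open>b < a\<close>) and \<open>e\<^sub>i\<^sup>2 = -1\<close> (one sign for each
  \<open>a \<in> A \<inter> B\<close>) give \<open>e\<^sub>A e\<^sub>B = blade_sign A B \<cdot> e\<^sub>C\<close>, where \<open>C\<close> is the symmetric difference.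
\<close>

definition blade_sign :: "'n::{finite,linorder} set \<Rightarrow> 'n set \<Rightarrow> real" where
  "blade_sign A B = (-1) ^ card {(a, b). a \<in> A \<and> b \<in> B \<and> b \<le> a}"

typedef (overloaded) ('n::"{finite,linorder}") clifford = "UNIV :: (real ^ ('n set)) set"
  morphisms coords of_coords by simp

text \<open>
  The module \<open>V\<close>, the direct sum of \<open>V\<^sub>\<real> \<otimes> e\<^sub>A\<close> over all \<open>A\<close>, is \<^typ>\<open>'v ^ ('n set)\<close>, where
  \<^term>\<open>axis A v\<close> is \<open>v \<otimes> e\<^sub>A\<close>; the library norm of this type is the required one.
\<close>

definition lmult :: "'n::{finite,linorder} clifford \<Rightarrow> 'v::real_normed_vector ^ ('n set) \<Rightarrow> 'v ^ ('n set)"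
  where "lmult a v = (\<Sum>A\<in>UNIV. \<Sum>B\<in>UNIV.
           (coords a $ A * blade_sign A B) *\<^sub>R axis (sym_diff A B) (v $ B))"

definition rmult :: "'v::real_normed_vector ^ ('n set) \<Rightarrow> 'n::{finite,linorder} clifford \<Rightarrow> 'v ^ ('n set)"
  where "rmult v a = (\<Sum>B\<in>UNIV. \<Sum>A\<in>UNIV.
           (coords a $ A * blade_sign B A) *\<^sub>R axis (sym_diff B A) (v $ B))"

lemma norm_vec_power2: "(norm (v :: 'v::real_normed_vector ^ 'i::finite))\<^sup>2 = (\<Sum>i\<in>UNIV. (norm (v $ i))\<^sup>2)"
  by (simp add: norm_vec_def L2_set_def sum_nonneg)

lemma coords_eqI: "(\<And>A. coords x $ A = coords y $ A) \<Longrightarrow> x = y"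
  by (metis coords_inject vec_eq_iff)

instantiation clifford :: ("{finite,linorder}") real_vector
begin

definition zero_clifford where "0 = of_coords 0"
definition plus_clifford where "x + y = of_coords (coords x + coords y)"
definition minus_clifford where "x - y = of_coords (coords x - coords y)"
definition uminus_clifford where "- x = of_coords (- coords x)"
definition scaleR_clifford where "r *\<^sub>R x = of_coords (r *\<^sub>R coords x)"

lemma coords_simps [simp]:
  "coords 0 = 0"
  "coords (x + y) = coords x + coords y"
  "coords (x - y) = coords x - coords y"
  "coords (- x) = - coords x"
  "coords (r *\<^sub>R x) = r *\<^sub>R coords x"
  by (simp_all add: zero_clifford_def plus_clifford_def minus_clifford_def uminus_clifford_def
      scaleR_clifford_def of_coords_inverse)

instance
  by standard (auto intro!: coords_eqI simp: algebra_simps)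

end

instantiation clifford :: ("{finite,linorder}") real_normed_vector
begin

definition norm_clifford where "norm x = norm (coords x)"
definition sgn_clifford where "sgn x = x /\<^sub>R norm x" for x :: "'a clifford"
definition dist_clifford where "dist x y = norm (x - y)" for x :: "'a clifford"
definition uniformity_clifford :: "('a clifford \<times> 'a clifford) filter"
  where "uniformity_clifford = (INF e\<in>{0 <..}. principal {(x, y). dist x y < e})"
definition open_clifford :: "'a clifford set \<Rightarrow> bool"
  where "open_clifford U \<longleftrightarrow> (\<forall>x\<in>U. eventually (\<lambda>(x', y). x' = x \<longrightarrow> y \<in> U) uniformity)"

instance
proof
  fix x y :: "'a clifford" and r :: real
  show "norm x = 0 \<longleftrightarrow> x = 0"
    by (metis coords_inject coords_simps(1) norm_clifford_def norm_eq_zero)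
  show "norm (x + y) \<le> norm x + norm y"
    by (simp add: norm_clifford_def norm_triangle_ineq)
  show "norm (r *\<^sub>R x) = \<bar>r\<bar> * norm x"
    by (simp add: norm_clifford_def)
qed (auto simp: sgn_clifford_def dist_clifford_def uniformity_clifford_def open_clifford_def)

end

lemma sum_axis_sym_diff:
  fixes v :: "'a::finite set \<Rightarrow> 'v::real_normed_vector"
  shows "(\<Sum>B\<in>UNIV. c B *\<^sub>R axis (sym_diff A B) (v B)) $ C = c (sym_diff A C) *\<^sub>R v (sym_diff A C)"
proof -
  have "(\<Sum>B\<in>UNIV. c B *\<^sub>R axis (sym_diff A B) (v B)) $ C
      = (\<Sum>B\<in>UNIV. if sym_diff A C = B then c B *\<^sub>R v B else 0)"
    unfolding sum_component
  proof (intro sum.cong refl)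
    fix B
    have "C = sym_diff A B \<longleftrightarrow> sym_diff A C = B" by blast
    then show "(c B *\<^sub>R axis (sym_diff A B) (v B)) $ C = (if sym_diff A C = B then c B *\<^sub>R v B else 0)"
      by (simp add: axis_def)
  qed
  then show ?thesis by simp
qed

lemma lmult_nth: "lmult a v $ C
    = (\<Sum>A\<in>UNIV. (coords a $ A * blade_sign A (sym_diff A C)) *\<^sub>R v $ (sym_diff A C))"
  by (simp only: lmult_def sum_component sum_axis_sym_diff [unfolded sum_component])

lemma power_card_eq_prod: "finite A \<Longrightarrow> (-1::real) ^ card {x\<in>A. P x} = (\<Prod>x\<in>A. if P x then -1 else 1)"
  by (simp add: prod.If_cases Int_def)

lemma blade_sign_prod: "blade_sign A B = (\<Prod>a\<in>A. \<Prod>b\<in>B. if b \<le> a then -1 else 1)"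
proof -
  have "{(a, b). a \<in> A \<and> b \<in> B \<and> b \<le> a} = {x \<in> A \<times> B. snd x \<le> fst x}" by auto
  then show ?thesis
    by (simp add: blade_sign_def power_card_eq_prod prod.cartesian_product case_prod_beta)
qed

lemma prod_sym_diff:
  fixes g :: "'a::finite \<Rightarrow> real"
  assumes "\<And>x. g x * g x = 1"
  shows "prod g (sym_diff A B) = prod g A * prod g B"
proof -
  have "prod g A * prod g B = (prod g (A - B) * prod g (A \<inter> B)) * (prod g (B - A) * prod g (A \<inter> B))"
    by (metis (no_types) Int_commute finite_code prod.Int_Diff mult.commute)
  also have "\<dots> = prod g (A - B) * prod g (B - A) * (\<Prod>x\<in>A \<inter> B. g x * g x)"
    by (simp add: prod.distrib)
  also have "\<dots> = prod g (sym_diff A B)"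
    by (subst prod.union_disjoint) (auto simp: assms)
  finally show ?thesis by simp
qed

lemma blade_sign_sym_diff:
  "blade_sign (sym_diff A B) C = blade_sign A C * blade_sign B C"
  "blade_sign A (sym_diff B C) = blade_sign A B * blade_sign A C"
proof -
  have *: "(\<Prod>b\<in>C. if b \<le> a then -1 else 1) * (\<Prod>b\<in>C. if b \<le> a then -1 else 1) = (1::real)"
    for a unfolding prod.distrib [symmetric] by (rule prod.neutral) simp
  show "blade_sign (sym_diff A B) C = blade_sign A C * blade_sign B C"
    unfolding blade_sign_prod by (rule prod_sym_diff) (rule *)
  show "blade_sign A (sym_diff B C) = blade_sign A B * blade_sign A C"
    unfolding blade_sign_prod prod.distrib [symmetric] by (intro prod.cong refl prod_sym_diff) simp
qed

lemma blade_sign_empty [simp]: "blade_sign {} B = 1" "blade_sign A {} = 1"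
  by (simp_all add: blade_sign_def)

lemma lmult_lmult:
  fixes x y :: "'a::{finite,linorder} clifford"
  shows "lmult (of_coords (lmult x (coords y))) v = lmult x (lmult y v)"
proof (rule iffD2 [OF vec_eq_iff], rule allI)
  fix C :: "'a set"
  have sd: "sym_diff A (sym_diff A B) = B" for A B :: "'a set" by blast
  have "lmult (of_coords (lmult x (coords y))) v $ C
      = (\<Sum>D\<in>UNIV. \<Sum>A\<in>UNIV. (coords x $ A * blade_sign A (sym_diff A D) * coords y $ (sym_diff A D)
          * blade_sign D (sym_diff D C)) *\<^sub>R v $ (sym_diff D C))"
    by (simp add: lmult_nth of_coords_inverse sum_distrib_right scaleR_sum_left)
  also have "\<dots> = (\<Sum>A\<in>UNIV. \<Sum>D\<in>UNIV. (coords x $ A * blade_sign A (sym_diff A D)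
          * coords y $ (sym_diff A D) * blade_sign D (sym_diff D C)) *\<^sub>R v $ (sym_diff D C))"
    by (rule sum.swap)
  also have "\<dots> = (\<Sum>A\<in>UNIV. \<Sum>B\<in>UNIV. (coords x $ A * blade_sign A B
          * coords y $ B * blade_sign (sym_diff A B) (sym_diff (sym_diff A B) C))
          *\<^sub>R v $ (sym_diff (sym_diff A B) C))"
  proof (rule sum.cong [OF refl])
    fix A :: "'a set"
    have "bij (sym_diff A)" by (rule o_bij [where g = "sym_diff A"]) auto
    from sum.reindex_bij_betw [OF this, symmetric]
    show "(\<Sum>D\<in>UNIV. (coords x $ A * blade_sign A (sym_diff A D)
          * coords y $ (sym_diff A D) * blade_sign D (sym_diff D C)) *\<^sub>R v $ (sym_diff D C))
      = (\<Sum>B\<in>UNIV. (coords x $ A * blade_sign A B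
          * coords y $ B * blade_sign (sym_diff A B) (sym_diff (sym_diff A B) C))
          *\<^sub>R v $ (sym_diff (sym_diff A B) C))"
      by (rule trans) (simp only: sd)
  qed
  also have "\<dots> = (\<Sum>A\<in>UNIV. \<Sum>B\<in>UNIV. (coords x $ A * blade_sign A (sym_diff A C)
          * (coords y $ B * blade_sign B (sym_diff B (sym_diff A C))))
          *\<^sub>R v $ (sym_diff B (sym_diff A C)))"
  proof (intro sum.cong refl)
    fix A B :: "'a set"
    define E where "E = sym_diff B (sym_diff A C)"
    have E: "sym_diff (sym_diff A B) C = E" "sym_diff A C = sym_diff B E"
      by (auto simp: E_def)
    show "(coords x $ A * blade_sign A B * coords y $ B
            * blade_sign (sym_diff A B) (sym_diff (sym_diff A B) C)) *\<^sub>R v $ (sym_diff (sym_diff A B) C)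
        = (coords x $ A * blade_sign A (sym_diff A C)
            * (coords y $ B * blade_sign B (sym_diff B (sym_diff A C)))) *\<^sub>R v $ (sym_diff B (sym_diff A C))"
      unfolding E(1) E_def [symmetric] unfolding E(2) blade_sign_sym_diff by (simp add: mult_ac)
  qed
  also have "\<dots> = lmult x (lmult y v) $ C"
    by (simp add: lmult_nth scaleR_sum_right)
  finally show "lmult (of_coords (lmult x (coords y))) v $ C = lmult x (lmult y v) $ C" .
qed

instantiation clifford :: ("{finite,linorder}") real_algebra_1
begin

text \<open>As a left module over itself, the Clifford algebra is the case \<open>V\<^sub>\<real> = \<real>\<close> of \<^const>\<open>lmult\<close>.\<close>

definition times_clifford where "x * y = of_coords (lmult x (coords y))"
definition one_clifford where "1 = of_coords (axis {} 1)"

instance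
proof
  fix a b c :: "'a clifford" and r :: real
  show "a * b * c = a * (b * c)"
    by (simp add: times_clifford_def lmult_lmult of_coords_inverse)
  show "1 * a = a"
    by (rule coords_eqI) (simp add: times_clifford_def one_clifford_def lmult_nth of_coords_inverse
        axis_def if_distrib [where f = "\<lambda>x. x * _"] cong: if_cong)
  have *: "A \<subseteq> C \<and> C \<subseteq> A \<longleftrightarrow> A = C" for A C :: "'a set" by blast
  show "a * 1 = a"
    by (rule coords_eqI) (simp add: times_clifford_def one_clifford_def lmult_nth of_coords_inverse
        axis_def * if_distrib [where f = "\<lambda>x. _ * x"] cong: if_cong)
  show "(0::'a clifford) \<noteq> 1"
    by (metis axis_eq_0_iff coords_simps(1) of_coords_inverse UNIV_I one_clifford_def zero_neq_one)
qed (rule coords_eqI; simp add: times_clifford_def lmult_nth of_coords_inverse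
      algebra_simps sum.distrib sum_distrib_left)+

end

definition basis_elt :: "'n::{finite,linorder} \<Rightarrow> 'n clifford" where
  "basis_elt i = of_coords (axis {i} 1)"

lemma basis_elt_mult: "basis_elt i * basis_elt j = blade_sign {i} {j} *\<^sub>R of_coords (axis (sym_diff {i} {j}) 1)"
proof -
  have **: "sym_diff A (sym_diff A B) = B" for A B :: "'a set" by blast
  have *: "sym_diff A C = {j} \<longleftrightarrow> C = sym_diff A {j}" for A C :: "'a set" by blast
  have "coords (basis_elt i * basis_elt j) $ C
      = (\<Sum>A\<in>UNIV. if A = {i} then blade_sign A (sym_diff A C) * (if sym_diff A C = {j} then 1 else 0) else 0)"
    for C
    unfolding basis_elt_def times_clifford_def lmult_nth of_coords_inverse [OF UNIV_I]
    by (intro sum.cong refl) (simp add: axis_def)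
  then show ?thesis
    by (intro coords_eqI) (simp add: * ** of_coords_inverse axis_def)
qed

lemma basis_elt_sq: "basis_elt i * basis_elt i = - 1"
proof -
  have "{(a, b). a \<in> {i} \<and> b \<in> {i} \<and> b \<le> a} = {(i, i)}" by auto
  then show ?thesis
    by (simp add: basis_elt_mult blade_sign_def one_clifford_def)
qed

lemma basis_elt_anticommute:
  assumes "i \<noteq> j" shows "basis_elt i * basis_elt j = - (basis_elt j * basis_elt i)"
proof -
  have "{(a, b). a \<in> {i} \<and> b \<in> {j} \<and> b \<le> a} = (if j \<le> i then {(i, j)} else {})" for i j :: 'a
    by auto
  then have "blade_sign {i} {j} = - blade_sign {j} {i}"
    using assms by (auto simp: blade_sign_def)
  then show ?thesis
    by (simp add: basis_elt_mult Un_commute)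
qed

definition paravectors :: "'n::{finite,linorder} clifford set" where
  "paravectors = {of_real x0 + (\<Sum>i\<in>UNIV. x i *\<^sub>R basis_elt i) | x0 x. True}"

definition real_part :: "'n::{finite,linorder} clifford \<Rightarrow> real" where
  "real_part s = coords s $ {}"

text \<open>Only meant for paravectors.\<close>

definition conj_para :: "'n::{finite,linorder} clifford \<Rightarrow> 'n clifford" where
  "conj_para s = of_real (real_part s) - (\<Sum>i\<in>UNIV. (coords s $ {i}) *\<^sub>R basis_elt i)"

definition unit_sphere :: "'n::{finite,linorder} clifford set" where
  "unit_sphere = {s \<in> paravectors. real_part s = 0 \<and> norm s = 1}"

text \<open>\<open>x + J y\<close>, and \<open>e\<^bsup>J\<phi>\<^esup>\<close> by Euler's formula (\<open>J\<^sup>2 = -1\<close> for \<open>J\<close> in the unit sphere).\<close>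

definition slice_pt :: "'n::{finite,linorder} clifford \<Rightarrow> real \<times> real \<Rightarrow> 'n clifford" where
  "slice_pt J z = of_real (fst z) + snd z *\<^sub>R J"

definition cexpJ :: "'n::{finite,linorder} clifford \<Rightarrow> real \<Rightarrow> 'n clifford" where
  "cexpJ J \<phi> = of_real (cos \<phi>) + sin \<phi> *\<^sub>R J"

text \<open>
  \<open>U\<close> is meant to be an axially symmetric, relatively open set of paravectors; only the values of \<open>f\<close>
  on \<open>U\<close> matter.  \<open>D0\<close>, \<open>D1\<close> are the (continuous) Frechet derivatives of \<open>f0\<close>, \<open>f1\<close>, whose values at
  \<open>(1, 0)\<close> and \<open>(0, 1)\<close> are the partial derivatives.
\<close>

definition slice_domain :: "'n::{finite,linorder} clifford set \<Rightarrow> (real \<times> real) set" where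
  "slice_domain U = {z. \<forall>J\<in>unit_sphere. slice_pt J z \<in> U}"

definition slice_hyperholomorphic ::
    "'n::{finite,linorder} clifford set \<Rightarrow> ('n clifford \<Rightarrow> 'n clifford) \<Rightarrow> bool" where
  "slice_hyperholomorphic U f \<longleftrightarrow>
     (\<exists>(f0 :: real \<times> real \<Rightarrow> 'n clifford) (f1 :: real \<times> real \<Rightarrow> 'n clifford)
        (D0 :: real \<times> real \<Rightarrow> (real \<times> real) \<Rightarrow>\<^sub>L 'n clifford)
        (D1 :: real \<times> real \<Rightarrow> (real \<times> real) \<Rightarrow>\<^sub>L 'n clifford).
        continuous_on (slice_domain U) D0 \<and> continuous_on (slice_domain U) D1 \<and>
        (\<forall>z\<in>slice_domain U.
           (f0 has_derivative blinfun_apply (D0 z)) (at z) \<and>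
           (f1 has_derivative blinfun_apply (D1 z)) (at z) \<and>
           (\<forall>J\<in>unit_sphere. f (slice_pt J z) = f0 z + J * f1 z) \<and>
           f0 (fst z, - snd z) = f0 z \<and>
           f1 (fst z, - snd z) = - f1 z \<and>
           D0 z (1, 0) = D1 z (0, 1) \<and>
           D0 z (0, 1) = - D1 z (1, 0)))"

text \<open>
  A partially defined operator is a partial function with the library's domain \<^const>\<open>dom\<close> and
  composition \<^const>\<open>map_comp\<close>, so that domains of compositions are the natural ones.
\<close>

type_synonym ('v, 'n) clifford_op = "'v ^ ('n set) \<Rightarrow> ('v ^ ('n set)) option"

definition right_linear_op :: "('v::real_normed_vector, 'n::{finite,linorder}) clifford_op \<Rightarrow> bool" where
  "right_linear_op T \<longleftrightarrow>
     0 \<in> dom T \<and>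
     (\<forall>u v x y. T u = Some x \<longrightarrow> T v = Some y \<longrightarrow> T (u + v) = Some (x + y)) \<and>
     (\<forall>u x a. T u = Some x \<longrightarrow> T (rmult u a) = Some (rmult x a))"

definition closed_ops :: "('v::banach, 'n::{finite,linorder}) clifford_op set" where
  "closed_ops = {T. right_linear_op T \<and> closed {(u, x). T u = Some x}}"

definition bounded_ops :: "(('v::banach ^ ('n::{finite,linorder} set)) \<Rightarrow>\<^sub>L ('v ^ ('n set))) set" where
  "bounded_ops = {B. \<forall>v a. blinfun_apply B (rmult v a) = rmult (blinfun_apply B v) a}"

primrec op_power :: "('v::banach, 'n::{finite,linorder}) clifford_op \<Rightarrow> nat \<Rightarrow> ('v, 'n) clifford_op" where
  "op_power T 0 = Some"
| "op_power T (Suc k) = T \<circ>\<^sub>m op_power T k"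

definition op_poly :: "real poly \<Rightarrow> ('v::banach, 'n::{finite,linorder}) clifford_op \<Rightarrow> ('v, 'n) clifford_op"
  where "op_poly p T v =
    (if v \<in> dom (op_power T (degree p))
     then Some (\<Sum>k\<le>degree p. coeff p k *\<^sub>R the (op_power T k v)) else None)"

definition Q_op :: "('v::banach, 'n::{finite,linorder}) clifford_op \<Rightarrow> 'n clifford \<Rightarrow> ('v, 'n) clifford_op"
  where "Q_op T s v =
    (if v \<in> dom (op_power T 2)
     then Some (the (op_power T 2 v) - (2 * real_part s) *\<^sub>R the (T v) + (norm s)\<^sup>2 *\<^sub>R v) else None)"

definition is_bounded_inverse ::
    "('v::banach, 'n::{finite,linorder}) clifford_op \<Rightarrow> (('v ^ ('n set)) \<Rightarrow>\<^sub>L ('v ^ ('n set))) \<Rightarrow> bool" where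
  "is_bounded_inverse A B \<longleftrightarrow> B \<in> bounded_ops \<and> (\<forall>u v. A u = Some v \<longleftrightarrow> blinfun_apply B v = u)"

definition S_resolvent_set :: "('v::banach, 'n::{finite,linorder}) clifford_op \<Rightarrow> 'n clifford set" where
  "S_resolvent_set T = {s \<in> paravectors. \<exists>B. is_bounded_inverse (Q_op T s) B}"

definition S_spectrum :: "('v::banach, 'n::{finite,linorder}) clifford_op \<Rightarrow> 'n clifford set" where
  "S_spectrum T = paravectors - S_resolvent_set T"

text \<open>The inverse in the next definition is unique, since its graph is the converse of that of \<^term>\<open>Q_op T s\<close>.\<close>

definition Q_inv :: "('v::banach, 'n::{finite,linorder}) clifford_op \<Rightarrow> 'n clifford
    \<Rightarrow> ('v ^ ('n set)) \<Rightarrow>\<^sub>L ('v ^ ('n set))" where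
  "Q_inv T s = (THE B. is_bounded_inverse (Q_op T s) B)"

definition S_resolvent :: "('v::banach, 'n::{finite,linorder}) clifford_op \<Rightarrow> 'n clifford
    \<Rightarrow> 'v ^ ('n set) \<Rightarrow> 'v ^ ('n set)" where
  "S_resolvent T s v = Q_inv T s (lmult (conj_para s) v) - the (T (Q_inv T s v))"

definition angle_set :: "real \<Rightarrow> real set" where
  "angle_set \<omega> = {- \<omega> <..< \<omega>} \<union> {pi - \<omega> <..< pi + \<omega>}"

definition bisector :: "real \<Rightarrow> 'n::{finite,linorder} clifford set" where
  "bisector \<omega> = {r *\<^sub>R cexpJ J \<phi> | r J \<phi>. 0 < r \<and> J \<in> unit_sphere \<and> \<phi> \<in> angle_set \<omega>}"

text \<open>
  The bound on the operator norm is unfolded, since \<^const>\<open>S_resolvent\<close> is a plain function: \<^const>\<open>onorm\<close>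
  is only meaningful for functions already known to be bounded.
\<close>

definition bisectorial :: "real \<Rightarrow> ('v::banach, 'n::{finite,linorder}) clifford_op \<Rightarrow> bool" where
  "bisectorial \<omega> T \<longleftrightarrow>
     T \<in> closed_ops \<and>
     S_spectrum T \<subseteq> closure (bisector \<omega>) \<and>
     (\<forall>\<phi>\<in>{\<omega> <..< pi / 2}. \<exists>C\<ge>0. \<forall>s \<in> paravectors - (bisector \<phi> \<union> {0}).
        \<forall>v. norm (S_resolvent T s v) \<le> C / norm s * norm v)"

definition SH0 :: "real \<Rightarrow> ('n::{finite,linorder} clifford \<Rightarrow> 'n clifford) set" where
  "SH0 \<theta> = {f. slice_hyperholomorphic (bisector \<theta>) f \<and> bounded (f ` bisector \<theta>) \<and>
     (\<forall>J\<in>unit_sphere. \<forall>\<phi>\<in>angle_set \<theta>.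
        (\<lambda>t. norm (f (t *\<^sub>R cexpJ J \<phi>)) / t) absolutely_integrable_on {0<..})}"

text \<open>The argument \<open>\<epsilon>\<close> is the sign \<open>\<plusminus>\<close>, that is \<open>1\<close> or \<open>-1\<close>.\<close>

definition path_bisector :: "real \<Rightarrow> 'n::{finite,linorder} clifford \<Rightarrow> real \<Rightarrow> real \<Rightarrow> 'n clifford" where
  "path_bisector \<phi> J \<epsilon> t = (\<epsilon> * \<bar>t\<bar>) *\<^sub>R cexpJ J (- (sgn t * \<phi>))"

text \<open>
  For bisectorial \<open>T\<close> and \<open>f \<in> SH0 \<theta>\<close> the operator \<open>f(T)\<close> does not depend on the parameters
  \<open>\<phi> \<in> (\<omega>, \<theta>)\<close> and \<open>J\<close>.  The integrals are taken in the Banach space of bounded operators, where the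
  Henstock-Kurzweil integral applies directly (Bochner integrals need second countability).  Division by \<open>J\<close> is multiplication by
  \<open>J\<^sup>-\<^sup>1 = - J\<close>.  The path is not differentiable at \<open>t = 0\<close>, which is a null set.
\<close>

definition omega_calculus :: "('v::banach, 'n::{finite,linorder}) clifford_op \<Rightarrow> real \<Rightarrow> 'n clifford
    \<Rightarrow> ('n clifford \<Rightarrow> 'n clifford) \<Rightarrow> ('v ^ ('n set)) \<Rightarrow>\<^sub>L ('v ^ ('n set))" where
  "omega_calculus T \<phi> J f = (1 / (2 * pi)) *\<^sub>R (\<Sum>\<epsilon>\<in>{1, -1}. integral UNIV (\<lambda>t.
     Blinfun (\<lambda>v. S_resolvent T (path_bisector \<phi> J \<epsilon> t)
       (lmult (vector_derivative (path_bisector \<phi> J \<epsilon>) (at t) * (- J) * f (path_bisector \<phi> J \<epsilon> t)) v))))"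

definition intrinsic_poly :: "real poly \<Rightarrow> 'n::{finite,linorder} clifford \<Rightarrow> 'n clifford" where
  "intrinsic_poly p s = (\<Sum>k\<le>degree p. coeff p k *\<^sub>R s ^ k)"

end

theory Submission
  imports Defs "HOL-Complex_Analysis.Cauchy_Integral_Theorem"
begin

text \<open>
  Multiplying the integrand of \<open>f(T)\<close> by \<open>T\<close> and using the resolvent equation \<open>T S(s) = S(s) s - 1\<close> gives
  formally \<open>T f(T) = (s f)(T) - \<integral> ds\<^sub>J f(s)\<close>, and the last integral vanishes by Cauchy's theorem.  Growth of
  \<open>p\<close> at infinity bounds \<open>|s|\<^sup>k |f|\<close> by \<open>|f| + |p f|\<close> for \<open>k \<le> m\<close>, so all integrals for \<open>s\<^sup>k f\<close> converge absolutely
  and the step can be iterated up to \<open>k = m\<close>; closedness of \<open>T\<close> lets it pass under the integral sign.  Cauchy's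
  theorem on the unbounded sector is delicate because the functions are only known to be integrable along each ray
  separately: a primitive exists since the sector is convex, and the contribution of the large arcs tends to zero
  along suitable radii, found by averaging over \<open>[n, 2n]\<close>.
\<close>

section \<open>Henstock-Kurzweil integrals in Banach spaces\<close>

text \<open>The step from k to k + 1 uses s^k f and s^(k+1) f together. Integrability of s^(k+1) f
  for dt/t makes s^k f integrable for dt on every ray, and boundedness of s^(k+1) f gives t |s^k f|
  \<le> M. The latter bounds the mass of a ray on [n, 2n] independently of the angle, so dominated
  convergence over the angles turns the separate decay along the rays into decay of the mean arc
  integral. A paravector s need not commute with \<open>T\<close>; the resolvent equation holds
  because s + conj(s) and conj(s) s are real. Cauchy's theorem is applied to scalar functions: left
  multiplication by C_J makes the Clifford algebra a complex vector space, whose coordinates are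
  seen through complex linear functionals. The integrals of operators live in a Banach space that
  may be infinite-dimensional and non-separable, so integrability by domination is derived from
  Riemann sums for continuous integrands.\<close>

lemma integrable_approx_interval:
  fixes f :: "'n::euclidean_space \<Rightarrow> 'b::banach"
  assumes "\<And>e. e > 0 \<Longrightarrow> \<exists>g h. g integrable_on cbox a b \<and> h integrable_on cbox a b \<and>
      integral (cbox a b) h < e \<and> (\<forall>x\<in>cbox a b. norm (f x - g x) \<le> h x)"
  shows "f integrable_on cbox a b"
  unfolding integrable_Cauchy
proof (intro allI impI)
  fix e :: real assume "e > 0"
  then have e: "e / 6 > 0" by simp
  obtain g h where g: "g integrable_on cbox a b" and h: "h integrable_on cbox a b"
    and hi: "integral (cbox a b) h < e / 6" and le: "\<And>x. x \<in> cbox a b \<Longrightarrow> norm (f x - g x) \<le> h x"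
    using assms [OF e] by blast
  obtain d1 where d1: "gauge d1" "\<And>p. p tagged_division_of cbox a b \<Longrightarrow> d1 fine p \<Longrightarrow>
      norm ((\<Sum>(x,K)\<in>p. measure lborel K *\<^sub>R g x) - integral (cbox a b) g) < e / 6"
    using g e by (metis has_integral integrable_integral)
  obtain d2 where d2: "gauge d2" "\<And>p. p tagged_division_of cbox a b \<Longrightarrow> d2 fine p \<Longrightarrow>
      norm ((\<Sum>(x,K)\<in>p. measure lborel K *\<^sub>R h x) - integral (cbox a b) h) < e / 6"
    using h e by (metis has_integral integrable_integral)
  \<comment> \<open>A Riemann sum of \<open>f\<close> differs from that of \<open>g\<close> by at
    most that of \<open>h\<close>, so by less than \<open>e / 6 + e / 6\<close>; the one of
    \<open>g\<close> is within \<open>e / 6\<close> of its integral.\<close>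
  have *: "norm ((\<Sum>(x,K)\<in>p. measure lborel K *\<^sub>R f x) - integral (cbox a b) g) < e / 2"
    if p: "p tagged_division_of cbox a b" "d1 fine p" "d2 fine p" for p
  proof -
    have "norm ((\<Sum>(x,K)\<in>p. measure lborel K *\<^sub>R f x) - (\<Sum>(x,K)\<in>p. measure lborel K *\<^sub>R g x))
        = norm (\<Sum>(x,K)\<in>p. measure lborel K *\<^sub>R (f x - g x))"
      by (simp add: sum_subtractf [symmetric] case_prod_beta scaleR_diff_right)
    also have "\<dots> \<le> (\<Sum>(x,K)\<in>p. measure lborel K *\<^sub>R h x)"
    proof (rule order_trans [OF norm_sum sum_mono])
      fix y assume y: "y \<in> p"
      then have "fst y \<in> cbox a b"
        using tag_in_interval [OF p(1)] by (metis prod.collapse)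
      then show "norm (case y of (x, K) \<Rightarrow> measure lborel K *\<^sub>R (f x - g x)) \<le> (case y of (x, K) \<Rightarrow> measure lborel K *\<^sub>R h x)"
        using le by (simp add: case_prod_beta mult_left_mono)
    qed
    also have "\<dots> < e / 6 + e / 6"
      using d2(2) [OF p(1,3)] hi by (simp add: abs_if split: if_splits)
    finally have "norm ((\<Sum>(x,K)\<in>p. measure lborel K *\<^sub>R f x) - (\<Sum>(x,K)\<in>p. measure lborel K *\<^sub>R g x)) < e / 6 + e / 6" .
    then show ?thesis
      using norm_triangle_lt [of "(\<Sum>(x,K)\<in>p. measure lborel K *\<^sub>R f x) - (\<Sum>(x,K)\<in>p. measure lborel K *\<^sub>R g x)"
          "(\<Sum>(x,K)\<in>p. measure lborel K *\<^sub>R g x) - integral (cbox a b) g" "e / 2"] d1(2) [OF p(1,2)]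
      by simp
  qed
  show "\<exists>\<gamma>. gauge \<gamma> \<and> (\<forall>\<D>1 \<D>2. \<D>1 tagged_division_of cbox a b \<and> \<gamma> fine \<D>1 \<and>
      \<D>2 tagged_division_of cbox a b \<and> \<gamma> fine \<D>2 \<longrightarrow>
      norm ((\<Sum>(x,K)\<in>\<D>1. measure lborel K *\<^sub>R f x) - (\<Sum>(x,K)\<in>\<D>2. measure lborel K *\<^sub>R f x)) < e)"
  proof (intro exI [of _ "\<lambda>x. d1 x \<inter> d2 x"] conjI allI impI)
    show "gauge (\<lambda>x. d1 x \<inter> d2 x)" using d1(1) d2(1) by (rule gauge_Int)
    fix p q assume "p tagged_division_of cbox a b \<and> (\<lambda>x. d1 x \<inter> d2 x) fine p \<and>
      q tagged_division_of cbox a b \<and> (\<lambda>x. d1 x \<inter> d2 x) fine q"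
    then have "norm ((\<Sum>(x,K)\<in>p. measure lborel K *\<^sub>R f x) - integral (cbox a b) g) < e / 2"
      "norm ((\<Sum>(x,K)\<in>q. measure lborel K *\<^sub>R f x) - integral (cbox a b) g) < e / 2"
      using * by (auto simp: fine_Int)
    then show "norm ((\<Sum>(x,K)\<in>p. measure lborel K *\<^sub>R f x) - (\<Sum>(x,K)\<in>q. measure lborel K *\<^sub>R f x)) < e"
      using norm_triangle_half_l by metis
  qed
qed

text \<open>Only the end point 0 is critical on a compact interval: away from it continuity
  suffices, and the piece cut off is dominated by \<open>g\<close> on (0, 1/(n+1)), whose integral
  tends to 0. The global bound by \<open>g\<close> then takes care of infinity.\<close>

lemma integrable_on_greaterThan_dominated:
  fixes f :: "real \<Rightarrow> 'b::banach"
  assumes f: "continuous_on {0<..} f" and g: "g integrable_on {0<..}"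
    and le: "\<And>x. x > 0 \<Longrightarrow> norm (f x) \<le> g x"
  shows "f integrable_on {0<..}"
proof (rule integrable_on_all_intervals_integrable_bound [OF _ _ g])
  fix a b :: real
  have g': "(\<lambda>x. if x \<in> {0<..} then g x else 0) integrable_on cbox a b"
    using g by (rule integrable_altD)
  have g0: "0 \<le> g x" if "x > 0" for x using le [OF that] norm_ge_zero order_trans by blast
  have pos: "0 < x" if "1 / (1 + real n) \<le> x" for n x
    using that by (rule less_le_trans [rotated]) simp
  define h where "h n x = (if x \<in> {0<..<1 / real (Suc n)} then g x else 0)" for n x
  have hi: "h n integrable_on cbox a b" for n
  proof -
    have "g integrable_on {0<..} \<inter> cbox a b"
      using g' by (simp only: integrable_restrict_Int)
    moreover have "g integrable_on {1 / real (Suc n)..} \<inter> cbox a b" if "\<not> 1 / real (Suc n) > b"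
    proof -
      have "{1 / real (Suc n)..} \<inter> cbox a b = cbox (max a (1 / real (Suc n))) b" by auto
      moreover have "(\<lambda>x. if x \<in> {0<..} then g x else 0) integrable_on cbox (max a (1 / real (Suc n))) b"
        using g by (rule integrable_altD)
      then have "g integrable_on cbox (max a (1 / real (Suc n))) b"
        by (rule integrable_eq) (auto dest!: pos)
      ultimately show ?thesis by (simp only:)
    qed
    moreover have "{1 / real (Suc n)..} \<inter> cbox a b = {}" if "1 / real (Suc n) > b"
      using that by auto
    ultimately have "g integrable_on {1 / real (Suc n)..} \<inter> cbox a b"
      by (metis integrable_on_empty)
    then have "(\<lambda>x. if x \<in> {1 / real (Suc n)..} then g x else 0) integrable_on cbox a b"
      by (simp only: integrable_restrict_Int)
    from integrable_diff [OF g' this] show ?thesis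
      by (rule integrable_eq) (auto simp: h_def dest!: pos)
  qed
  have lim: "(\<lambda>n. integral (cbox a b) (h n)) \<longlonglongrightarrow> integral (cbox a b) (\<lambda>x. 0)"
  proof (rule dominated_convergence(2) [OF hi g'])
    show "norm (h n x) \<le> (if x \<in> {0<..} then g x else 0)" for n x
      using g0 by (simp add: h_def)
    show "(\<lambda>n. h n x) \<longlonglongrightarrow> 0" for x
    proof (cases "x > 0")
      case True
      have "eventually (\<lambda>n. 1 / real (Suc n) < x) sequentially"
        using LIMSEQ_inverse_real_of_nat True unfolding inverse_eq_divide by (rule order_tendstoD)
      then show ?thesis
        by (intro tendsto_eventually, elim eventually_mono) (auto simp: h_def)
    qed (simp add: h_def)
  qed
  show "(\<lambda>x. if x \<in> {0<..} then f x else 0) integrable_on cbox a b"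
  proof (rule integrable_approx_interval)
    fix e :: real assume "e > 0"
    then obtain n where n: "integral (cbox a b) (h n) < e"
      using order_tendstoD(2) [OF lim, of e] by (auto simp: eventually_sequentially)
    have "f integrable_on cbox (max a (1 / real (Suc n))) b"
      by (rule integrable_continuous, rule continuous_on_subset [OF f])
        (auto dest!: pos)
    moreover have "{1 / real (Suc n)..} \<inter> cbox a b = cbox (max a (1 / real (Suc n))) b" by auto
    ultimately have "(\<lambda>x. if x \<in> {1 / real (Suc n)..} then f x else 0) integrable_on cbox a b"
      by (simp only: integrable_restrict_Int)
    with n hi show "\<exists>G H. G integrable_on cbox a b \<and> H integrable_on cbox a b \<and>
      integral (cbox a b) H < e \<and> (\<forall>x\<in>cbox a b. norm ((if x \<in> {0<..} then f x else 0) - G x) \<le> H x)"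
      by (intro exI [of _ "\<lambda>x. if x \<in> {1 / real (Suc n)..} then f x else 0"] exI [of _ "h n"])
        (auto simp: h_def le not_less dest: pos)
  qed
qed (use le in auto)

text \<open>Riemann sums stay in \<open>G\<close>, and closedness keeps their limit there. With
  \<open>G\<close> the graph of a closed operator this is Hille's theorem on moving the operator
  under the integral sign.\<close>

lemma has_integral_in_closed_subspace:
  fixes h :: "'n::euclidean_space \<Rightarrow> 'b::real_normed_vector"
  assumes h: "(h has_integral I) UNIV" and G: "subspace G" "closed G" and hG: "\<And>x. h x \<in> G"
  shows "I \<in> G"
proof -
  have box: "z \<in> G" if "(h has_integral z) (cbox a b)" for z a b
  proof -
    have "\<exists>y\<in>G. dist y z < e" if "e > 0" for e
    proof -
      obtain d where d: "gauge d" "\<And>p. p tagged_division_of cbox a b \<Longrightarrow> d fine p \<Longrightarrow>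
          norm ((\<Sum>(x,K)\<in>p. measure lborel K *\<^sub>R h x) - z) < e"
        using \<open>(h has_integral z) (cbox a b)\<close> \<open>e > 0\<close> by (metis has_integral)
      obtain p where p: "p tagged_division_of cbox a b" "d fine p"
        using fine_division_exists [OF d(1)] by blast
      have "(\<Sum>(x,K)\<in>p. measure lborel K *\<^sub>R h x) \<in> G"
        by (rule subspace_sum [OF G(1)]) (auto intro: subspace_scale [OF G(1)] hG)
      with d(2) [OF p] show ?thesis by (metis dist_norm)
    qed
    then show ?thesis using G(2) by (metis closed_approachable)
  qed
  have "\<exists>y\<in>G. dist y I < e" if e: "e > 0" for e
  proof -
    obtain B where "\<forall>a b. ball 0 B \<subseteq> cbox a b \<longrightarrow>
        (\<exists>z. ((\<lambda>x. if x \<in> UNIV then h x else 0) has_integral z) (cbox a b) \<and> norm (z - I) < e)"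
      using has_integral_altD [OF h _ e] by (metis bounded_cbox not_bounded_UNIV)
    moreover obtain a b :: 'n where "ball 0 B \<subseteq> cbox a b"
      using bounded_subset_cbox_symmetric [OF bounded_ball] by metis
    ultimately obtain z where "(h has_integral z) (cbox a b)" "norm (z - I) < e"
      by (simp only: UNIV_I if_True) blast
    then show ?thesis using box by (auto simp: dist_norm)
  qed
  then show ?thesis using G(2) by (metis closed_approachable)
qed

lemma has_integral_Pair:
  assumes "(f has_integral i) S" "(g has_integral j) S"
  shows "((\<lambda>x. (f x, g x)) has_integral (i, j)) S"
proof -
  have "bounded_linear (\<lambda>x. (x, 0::'d::real_normed_vector))" "bounded_linear (\<lambda>x. (0::'e::real_normed_vector, x))"
    by (auto intro!: bounded_linear_intros)
  from has_integral_add [OF has_integral_linear [OF assms(1) this(1)] has_integral_linear [OF assms(2) this(2)]]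
  show ?thesis by (simp add: o_def)
qed

lemma has_integral_reflect_UNIV:
  fixes f :: "real \<Rightarrow> 'b::banach"
  assumes "(f has_integral i) UNIV"
  shows "((\<lambda>x. f (- x)) has_integral i) UNIV"
proof -
  have f: "f integrable_on cbox a b" for a b
    using assms unfolding has_integral_alt' [of f] by simp
  have "\<exists>B>0. \<forall>a b. ball 0 B \<subseteq> cbox a b \<longrightarrow> norm (integral (cbox a b) (\<lambda>x. f (- x)) - i) < e" if "0 < e" for e
  proof -
    obtain B where B: "B > 0" "\<And>a b. ball 0 B \<subseteq> cbox a b \<Longrightarrow> norm (integral (cbox a b) f - i) < e"
      using assms \<open>0 < e\<close> unfolding has_integral_alt' [of f] by auto
    have "norm (integral (cbox a b) (\<lambda>x. f (- x)) - i) < e" if ab: "ball 0 B \<subseteq> cbox a b" for a b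
    proof -
      have "x \<in> cbox (- b) (- a)" if "x \<in> ball 0 B" for x
        using subsetD [OF ab, of "- x"] that by auto
      then have "norm (integral (cbox (- b) (- a)) f - i) < e" by (intro B subsetI)
      then show ?thesis using integral_reflect [of "- a" "- b" f] by simp
    qed
    with B(1) show ?thesis by blast
  qed
  moreover have "(\<lambda>x. f (- x)) integrable_on cbox a b" for a b
    using f [of "- b" "- a"] integrable_reflect [of f "- a" "- b"] by simp
  ultimately show ?thesis
    unfolding has_integral_alt' [of "\<lambda>x. f (- x)"] by simp
qed

text \<open>Made for the boundary path, which is parametrised over the whole line and has a corner
  at 0: both halves are brought to \<open>{0<..}\<close>.\<close>

lemma has_integral_split_zero:
  fixes f :: "real \<Rightarrow> 'b::banach"
  assumes "(f has_integral i) {0<..}" and "((\<lambda>x. f (- x)) has_integral j) {0<..}"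
  shows "(f has_integral (i + j)) UNIV"
proof -
  have "((\<lambda>x. if x \<in> {0<..} then f (- x) else 0) has_integral j) UNIV"
    using assms(2) by (simp only: has_integral_restrict_UNIV)
  from has_integral_reflect_UNIV [OF this]
  have "((\<lambda>x. if x \<in> {..<0} then f x else 0) has_integral j) UNIV"
    by (simp cong: if_cong)
  then have "(f has_integral j) {..<0}" by (simp only: has_integral_restrict_UNIV)
  moreover have "{0<..} \<inter> {..<0} = ({} :: real set)" by auto
  ultimately have "(f has_integral (i + j)) ({0<..} \<union> {..<0})"
    using assms(1) by (intro has_integral_Un) auto
  moreover have "{x \<in> UNIV - ({0<..} \<union> {..<0}). f x \<noteq> 0} \<subseteq> {0}" by auto
  then have "negligible {x \<in> UNIV - ({0<..} \<union> {..<0}). f x \<noteq> 0}"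
    by (rule negligible_subset [OF negligible_sing])
  ultimately show ?thesis
    by (subst has_integral_spike_set_eq [of UNIV "{0<..} \<union> {..<0}"]) auto
qed

section \<open>Cauchy's theorem for a sector\<close>

text \<open>For \<open>0 < \<theta> < pi / 2\<close> these are the points with argument in
  (-\<theta>, \<theta>). Without arguments the set is visibly an intersection of two
  half-planes.\<close>

definition sector :: "real \<Rightarrow> complex set" where
  "sector \<theta> = {z. \<bar>Im z\<bar> < tan \<theta> * Re z}"

lemma sector_open_convex: "open (sector \<theta>)" "convex (sector \<theta>)"
proof -
  have *: "sector \<theta> = {z. inner (Complex (tan \<theta>) (-1)) z > 0} \<inter> {z. inner (Complex (tan \<theta>) 1) z > 0}"
    by (auto simp: sector_def inner_complex_def)
  show "open (sector \<theta>)" "convex (sector \<theta>)"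
    unfolding * by (intro open_Int open_halfspace_gt convex_Int convex_halfspace_gt)+
qed

lemma abs_sin_less_tan_cos:
  assumes "\<theta> < pi / 2" "\<bar>\<psi>\<bar> < \<theta>"
  shows "\<bar>sin \<psi>\<bar> < tan \<theta> * cos \<psi>"
proof -
  have c: "cos \<psi> > 0" using assms by (intro cos_gt_zero_pi) auto
  have "tan \<psi> < tan \<theta>" "tan (- \<psi>) < tan \<theta>"
    using assms by (intro tan_monotone; linarith)+
  then have "\<bar>tan \<psi>\<bar> * cos \<psi> < tan \<theta> * cos \<psi>"
    using c by auto
  moreover have "\<bar>tan \<psi>\<bar> * cos \<psi> = \<bar>sin \<psi>\<bar>"
    using c by (simp add: tan_def)
  ultimately show ?thesis by simp
qed

lemma cis_in_sector:
  assumes "\<theta> < pi / 2" "\<bar>\<psi>\<bar> < \<theta>" "0 < t"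
  shows "of_real t * cis \<psi> \<in> sector \<theta>"
  using mult_strict_left_mono [OF abs_sin_less_tan_cos [OF assms(1,2)] assms(3)] assms(3)
  by (simp add: sector_def abs_mult mult_ac)

text \<open>The factors \<open>cis \<phi>\<close> and \<open>cis (- \<phi>)\<close> are dz/dt, so
  both sides are integrals of G dz along rays. Small arcs vanish by \<open>bd\<close> and their
  length. For large arcs \<open>bd1\<close> alone gives only boundedness; the decay has to come from
  \<open>int\<close>, ray by ray.\<close>

lemma sector_ray_integrals_eq:
  fixes G :: "complex \<Rightarrow> complex"
  assumes hol: "G holomorphic_on sector \<theta>" and \<phi>: "0 < \<phi>" "\<phi> < \<theta>" "\<theta> < pi / 2"
    and bd: "\<And>t \<psi>. 0 < t \<Longrightarrow> \<bar>\<psi>\<bar> \<le> \<phi> \<Longrightarrow> norm (G (of_real t * cis \<psi>)) \<le> M"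
    and bd1: "\<And>t \<psi>. 0 < t \<Longrightarrow> \<bar>\<psi>\<bar> \<le> \<phi> \<Longrightarrow> t * norm (G (of_real t * cis \<psi>)) \<le> M"
    and int: "\<And>\<psi>. \<bar>\<psi>\<bar> \<le> \<phi> \<Longrightarrow> (\<lambda>t. norm (G (of_real t * cis \<psi>))) integrable_on {0<..}"
  shows "integral {0<..} (\<lambda>t. cis \<phi> * G (of_real t * cis \<phi>))
       = integral {0<..} (\<lambda>t. cis (- \<phi>) * G (of_real t * cis (- \<phi>)))"
proof -
  have inS: "of_real t * cis \<psi> \<in> sector \<theta>" if "0 < t" "\<bar>\<psi>\<bar> \<le> \<phi>" for t \<psi>
    using that \<phi> by (intro cis_in_sector) auto
  obtain P where "\<And>z. z \<in> sector \<theta> \<Longrightarrow> (P has_field_derivative G z) (at z within sector \<theta>)"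
    using holomorphic_convex_primitive' [OF sector_open_convex(2,1) hol] by blast
  then have P: "(P has_field_derivative G z) (at z)" if "z \<in> sector \<theta>" for z
    using that by (metis at_within_open sector_open_convex(1))
  have contG: "continuous_on (sector \<theta>) G" using hol by (rule holomorphic_on_imp_continuous_on)
  have M: "0 \<le> M" using order_trans [OF norm_ge_zero bd [of 1 0]] \<phi> by simp
  \<comment> \<open>By \<open>arc\<close> this is the integral over the arc of radius
    \<open>t\<close>. It remains to send \<open>D\<close> to 0 along some radii tending to 0 and
    some tending to infinity.\<close>
  define D where "D t = P (of_real t * cis \<phi>) - P (of_real t * cis (- \<phi>))" for t :: real
  have arc: "((\<lambda>\<psi>. of_real t * (\<i> * cis \<psi>) * G (of_real t * cis \<psi>)) has_integral D t) {-\<phi>..\<phi>}"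
    if t: "0 < t" for t
    unfolding D_def
  proof (rule fundamental_theorem_of_calculus)
    fix \<psi> assume "\<psi> \<in> {-\<phi>..\<phi>}"
    then have m: "of_real t * cis \<psi> \<in> sector \<theta>" using t by (intro inS) auto
    have v: "((\<lambda>\<psi>. of_real t * cis \<psi>) has_vector_derivative of_real t * (\<i> * cis \<psi>)) (at \<psi> within {-\<phi>..\<phi>})"
      unfolding cis_conv_exp
      by (rule has_vector_derivative_real_field [where f = "\<lambda>z. of_real t * exp (\<i> * z)"])
        (auto intro!: derivative_eq_intros)
    show "((\<lambda>\<psi>. P (of_real t * cis \<psi>)) has_vector_derivative
        of_real t * (\<i> * cis \<psi>) * G (of_real t * cis \<psi>)) (at \<psi> within {-\<phi>..\<phi>})"
      using field_vector_diff_chain_within [OF v has_field_derivative_at_within [OF P [OF m]]]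
      by (simp add: o_def)
  qed (use \<phi> in auto)
  have ray: "((\<lambda>t. cis \<psi> * G (of_real t * cis \<psi>)) has_integral P (of_real b * cis \<psi>) - P (of_real a * cis \<psi>)) {a..b}"
    if "0 < a" "a \<le> b" "\<bar>\<psi>\<bar> \<le> \<phi>" for a b \<psi>
  proof (rule fundamental_theorem_of_calculus [OF \<open>a \<le> b\<close>])
    fix t assume "t \<in> {a..b}"
    then have m: "of_real t * cis \<psi> \<in> sector \<theta>" using that by (intro inS) auto
    have v: "((\<lambda>t. of_real t * cis \<psi>) has_vector_derivative cis \<psi>) (at t within {a..b})"
      by (auto intro!: derivative_eq_intros simp: has_vector_derivative_def scaleR_conv_of_real)
    show "((\<lambda>t. P (of_real t * cis \<psi>)) has_vector_derivative
        cis \<psi> * G (of_real t * cis \<psi>)) (at t within {a..b})"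
      using field_vector_diff_chain_within [OF v has_field_derivative_at_within [OF P [OF m]]]
      by (simp add: o_def)
  qed
  have contK: "continuous_on ({0<..} \<times> {-\<phi>..\<phi>}) (\<lambda>(t, \<psi>). norm (G (of_real t * cis \<psi>)))"
    unfolding case_prod_beta
    by (intro continuous_on_norm continuous_on_compose2 [OF contG] continuous_intros)
      (auto intro!: inS continuous_intros)
  have contR: "continuous_on {0<..} (\<lambda>t. G (of_real t * cis \<psi>))" if "\<bar>\<psi>\<bar> \<le> \<phi>" for \<psi>
    by (intro continuous_on_compose2 [OF contG] continuous_intros) (auto intro!: inS that)
  have contA: "continuous_on {-\<phi>..\<phi>} (\<lambda>\<psi>. G (of_real t * cis \<psi>))" if "0 < t" for t
    by (intro continuous_on_compose2 [OF contG] continuous_intros) (auto intro!: inS that)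
  have contD: "continuous_on {0<..} D"
  proof -
    have contP: "continuous_on (sector \<theta>) P"
      using P by (intro continuous_at_imp_continuous_on ballI DERIV_isCont)
    show ?thesis unfolding D_def
      by (intro continuous_on_diff continuous_on_compose2 [OF contP] continuous_intros)
        (use \<phi> in \<open>auto intro!: inS\<close>)
  qed
  have D_le: "norm (D t) \<le> integral {-\<phi>..\<phi>} (\<lambda>\<psi>. t * norm (G (of_real t * cis \<psi>)))" if t: "0 < t" for t
    unfolding integral_unique [OF arc [OF t], symmetric]
    by (rule integral_norm_bound_integral)
      (use t in \<open>auto intro!: integrable_continuous_interval contA continuous_intros has_integral_integrable [OF arc] simp: norm_mult\<close>)

  \<comment> \<open>The mass of one ray over [N, 2N] with N = n + 1. By \<open>bd1\<close> the
    integrand is at most M / N on an interval of length N, so the constant \<open>M\<close>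
    dominates for all angles; \<open>int\<close> gives pointwise convergence to 0.\<close>
  define k where "k n \<psi> = integral {real (Suc n)..2 * real (Suc n)} (\<lambda>t. norm (G (of_real t * cis \<psi>)))" for n \<psi>
  have k_lim: "(\<lambda>n. integral {-\<phi>..\<phi>} (k n)) \<longlonglongrightarrow> integral {-\<phi>..\<phi>} (\<lambda>\<psi>. 0)"
  proof (rule dominated_convergence(2) [where h = "\<lambda>_. M"])
    show "k n integrable_on {-\<phi>..\<phi>}" for n
      unfolding k_def
    proof (rule integrable_continuous_interval)
      have "continuous_on ({-\<phi>..\<phi>} \<times> cbox (real (Suc n)) (2 * real (Suc n))) (\<lambda>(\<psi>, t). norm (G (of_real t * cis \<psi>)))"
        unfolding case_prod_beta
        by (intro continuous_on_norm continuous_on_compose2 [OF contG] continuous_intros)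
          (auto intro!: inS continuous_intros)
      from integral_continuous_on_param [OF this]
      show "continuous_on {-\<phi>..\<phi>} (\<lambda>\<psi>. integral {real (Suc n)..2 * real (Suc n)} (\<lambda>t. norm (G (of_real t * cis \<psi>))))"
        by simp
    qed
    have kn: "(\<lambda>t. norm (G (of_real t * cis \<psi>))) integrable_on {real (Suc n)..2 * real (Suc n)}"
      if "\<psi> \<in> {-\<phi>..\<phi>}" for n \<psi>
      using that
      by (intro integrable_continuous_interval continuous_on_norm continuous_on_subset [OF contR]) auto
    show "norm (k n \<psi>) \<le> M" if "\<psi> \<in> {-\<phi>..\<phi>}" for n \<psi>
    proof -
      have "norm (k n \<psi>) \<le> M / real (Suc n) * measure lborel (cbox (real (Suc n)) (2 * real (Suc n)))"
        unfolding k_def cbox_interval [symmetric]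
      proof (rule integrable_bound)
        fix t assume t: "t \<in> cbox (real (Suc n)) (2 * real (Suc n))"
        then have "real (Suc n) * norm (G (of_real t * cis \<psi>)) \<le> t * norm (G (of_real t * cis \<psi>))"
          by (intro mult_right_mono) auto
        also have "\<dots> \<le> M" using t that by (intro bd1) auto
        finally show "norm (norm (G (of_real t * cis \<psi>))) \<le> M / real (Suc n)"
          by (simp add: field_simps)
      qed (use M kn [OF that] in auto)
      then show ?thesis by simp
    qed
    show "(\<lambda>n. k n \<psi>) \<longlonglongrightarrow> 0" if "\<psi> \<in> {-\<phi>..\<phi>}" for \<psi>
    proof -
      let ?g = "\<lambda>t. norm (G (of_real t * cis \<psi>))"
      have g: "?g integrable_on {0<..}" using that by (intro int) auto
      have "(\<lambda>n. integral {0<..} (\<lambda>t. if t \<in> {real (Suc n)..2 * real (Suc n)} then ?g t else 0))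
          \<longlonglongrightarrow> integral {0<..} (\<lambda>t::real. 0::real)"
      proof (rule dominated_convergence(2) [where h = ?g])
        have "{real (Suc n)..2 * real (Suc n)} \<inter> {0<..} = {real (Suc n)..2 * real (Suc n)}" for n
          by auto
        then show "(\<lambda>t. if t \<in> {real (Suc n)..2 * real (Suc n)} then ?g t else 0) integrable_on {0<..}" for n
          unfolding integrable_restrict_Int using kn [OF that] by (simp only:)
        show "(\<lambda>n. if t \<in> {real (Suc n)..2 * real (Suc n)} then ?g t else 0) \<longlonglongrightarrow> 0" for t
        proof (rule tendsto_eventually)
          have "eventually (\<lambda>n. t < real n) sequentially"
            using filterlim_real_sequentially by (simp add: filterlim_at_top_dense)
          then show "eventually (\<lambda>n. (if t \<in> {real (Suc n)..2 * real (Suc n)} then ?g t else 0) = 0) sequentially"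
            by eventually_elim auto
        qed
      qed (use g in auto)
      moreover have "{real (Suc n)..2 * real (Suc n)} \<inter> {0<..} = {real (Suc n)..2 * real (Suc n)}" for n
        by auto
      ultimately show ?thesis
        unfolding k_def integral_restrict_Int by (simp only: integral_0)
    qed
  qed (auto intro: integrable_const_ivl)
  \<comment> \<open>Take \<open>t\<close> minimising |D| on [N, 2N]. Then N |D t| is at most the
    integral of |D s| over s, where s \<le> 2N gives the factor 2N; exchanging the order of
    integration produces the integral of \<open>k n\<close>.\<close>
  have "\<exists>t\<in>{real (Suc n)..2 * real (Suc n)}. norm (D t) \<le> 2 * integral {-\<phi>..\<phi>} (k n)" for n
  proof -
    let ?N = "real (Suc n)"
    have sub: "{?N..2 * ?N} \<subseteq> {0<..}" by auto
    obtain t where t: "t \<in> {?N..2 * ?N}" and min: "\<And>s. s \<in> {?N..2 * ?N} \<Longrightarrow> norm (D t) \<le> norm (D s)"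
      using continuous_attains_inf [of "{?N..2 * ?N}" "\<lambda>t. norm (D t)"]
        continuous_on_norm [OF continuous_on_subset [OF contD sub]] by auto
    have cont: "continuous_on (cbox (?N, -\<phi>) (2 * ?N, \<phi>)) (\<lambda>(t, \<psi>). norm (G (of_real t * cis \<psi>)))"
      by (rule continuous_on_subset [OF contK]) (auto simp: cbox_Pair_eq)
    have "?N * norm (D t) = integral {?N..2 * ?N} (\<lambda>s. norm (D t))"
      by simp
    also have "\<dots> \<le> integral {?N..2 * ?N} (\<lambda>s. 2 * ?N * integral {-\<phi>..\<phi>} (\<lambda>\<psi>. norm (G (of_real s * cis \<psi>))))"
    proof (rule integral_le)
      have "continuous_on {?N..2 * ?N} (\<lambda>s. integral (cbox (-\<phi>) \<phi>) (\<lambda>\<psi>. norm (G (of_real s * cis \<psi>))))"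
        by (rule integral_continuous_on_param, rule continuous_on_subset [OF contK]) auto
      then show "(\<lambda>s. 2 * ?N * integral {-\<phi>..\<phi>} (\<lambda>\<psi>. norm (G (of_real s * cis \<psi>)))) integrable_on {?N..2 * ?N}"
        by (intro integrable_continuous_interval continuous_intros) simp
      fix s assume s: "s \<in> {?N..2 * ?N}"
      then have s0: "0 < s" using sub by auto
      have "norm (D t) \<le> norm (D s)" using s by (rule min)
      also have "\<dots> \<le> s * integral {-\<phi>..\<phi>} (\<lambda>\<psi>. norm (G (of_real s * cis \<psi>)))"
        using D_le [OF s0] by simp
      also have "\<dots> \<le> 2 * ?N * integral {-\<phi>..\<phi>} (\<lambda>\<psi>. norm (G (of_real s * cis \<psi>)))"
        using s s0 by (intro mult_right_mono integral_nonneg)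
          (auto intro!: integrable_continuous_interval continuous_intros contA)
      finally show "norm (D t) \<le> \<dots>" .
    qed auto
    also have "\<dots> = 2 * ?N * integral {-\<phi>..\<phi>} (k n)"
      using integral_swap_continuous [OF cont] by (simp add: k_def [abs_def])
    finally have "?N * norm (D t) \<le> ?N * (2 * integral {-\<phi>..\<phi>} (k n))"
      by (simp only: mult_ac)
    then have "norm (D t) \<le> 2 * integral {-\<phi>..\<phi>} (k n)"
      by (rule mult_left_le_imp_le) simp
    with t show ?thesis by blast
  qed
  then obtain r where r: "\<And>n. r n \<in> {real (Suc n)..2 * real (Suc n)}"
      "\<And>n. norm (D (r n)) \<le> 2 * integral {-\<phi>..\<phi>} (k n)"
    by metis
  have Dr: "(\<lambda>n. D (r n)) \<longlonglongrightarrow> 0"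
    by (rule Lim_null_comparison [OF always_eventually tendsto_eq_rhs [OF tendsto_mult_right_zero]])
      (use r(2) k_lim in auto)
  have D0: "(\<lambda>n. D (1 / real (Suc n))) \<longlonglongrightarrow> 0"
  proof (rule Lim_null_comparison [OF always_eventually])
    show "\<forall>n. norm (D (1 / real (Suc n))) \<le> (2 * \<phi> * M) * inverse (real (Suc n))"
    proof
      fix n
      define t where "t = 1 / real (Suc n)"
      have t: "0 < t" by (simp add: t_def)
      have "norm (D t) \<le> integral {-\<phi>..\<phi>} (\<lambda>\<psi>. t * norm (G (of_real t * cis \<psi>)))"
        using t by (rule D_le)
      also have "\<dots> \<le> integral {-\<phi>..\<phi>} (\<lambda>\<psi>. t * M)"
        using t bd by (intro integral_le) (auto intro!: integrable_continuous_interval continuous_intros contA)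
      finally show "norm (D (1 / real (Suc n))) \<le> (2 * \<phi> * M) * inverse (real (Suc n))"
        using \<phi> by (simp add: t_def field_simps)
    qed
    show "(\<lambda>n. (2 * \<phi> * M) * inverse (real (Suc n))) \<longlonglongrightarrow> 0"
      by (rule tendsto_mult_right_zero [OF LIMSEQ_inverse_real_of_nat])
  qed
  have lim: "(\<lambda>n. P (of_real (r n) * cis \<psi>) - P (of_real (1 / real (Suc n)) * cis \<psi>))
      \<longlonglongrightarrow> integral {0<..} (\<lambda>t. cis \<psi> * G (of_real t * cis \<psi>))" if \<psi>: "\<bar>\<psi>\<bar> \<le> \<phi>" for \<psi>
  proof -
    let ?g = "\<lambda>t. cis \<psi> * G (of_real t * cis \<psi>)"
    have b: "1 / real (Suc n) \<le> r n" for n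
    proof -
      have "1 / real (Suc n) \<le> 1" by simp
      also have "\<dots> \<le> real (Suc n)" by simp
      also have "\<dots> \<le> r n" using r(1) [of n] by simp
      finally show ?thesis .
    qed
    have sub: "{1 / real (Suc n)..r n} \<inter> {0<..} = {1 / real (Suc n)..r n}" for n
      by (auto intro: less_le_trans [of _ "1 / (1 + real n)"])
    have "(\<lambda>n. integral {0<..} (\<lambda>t. if t \<in> {1 / real (Suc n)..r n} then ?g t else 0)) \<longlonglongrightarrow> integral {0<..} ?g"
    proof (rule dominated_convergence(2) [where h = "\<lambda>t. norm (G (of_real t * cis \<psi>))"])
      show "(\<lambda>t. if t \<in> {1 / real (Suc n)..r n} then ?g t else 0) integrable_on {0<..}" for n
        unfolding integrable_restrict_Int sub using ray [OF _ b \<psi>] by (intro has_integral_integrable) auto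
      show "(\<lambda>n. if t \<in> {1 / real (Suc n)..r n} then ?g t else 0) \<longlonglongrightarrow> ?g t" if "t \<in> {0<..}" for t
      proof (rule tendsto_eventually)
        have "eventually (\<lambda>n. t < real n) sequentially"
          using filterlim_real_sequentially by (simp add: filterlim_at_top_dense)
        moreover have "eventually (\<lambda>n. inverse (real (Suc n)) < t) sequentially"
          using that by (intro order_tendstoD(2) [OF LIMSEQ_inverse_real_of_nat]) auto
        ultimately show "eventually (\<lambda>n. (if t \<in> {1 / real (Suc n)..r n} then ?g t else 0) = ?g t) sequentially"
        proof eventually_elim
          case (elim n)
          then show ?case using r(1) [of n] by (auto simp: inverse_eq_divide)
        qed
      qed
    qed (use int [OF \<psi>] in \<open>auto simp: norm_mult\<close>)
    moreover have "integral {0<..} (\<lambda>t. if t \<in> {1 / real (Suc n)..r n} then ?g t else 0)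
        = P (of_real (r n) * cis \<psi>) - P (of_real (1 / real (Suc n)) * cis \<psi>)" for n
      unfolding integral_restrict_Int sub using ray [OF _ b \<psi>] by (intro integral_unique) auto
    ultimately show ?thesis by (simp only:)
  qed
  \<comment> \<open>Both rays are truncated at the same radii, so their difference is a difference
    of arcs.\<close>
  have "(\<lambda>n. D (r n) - D (1 / real (Suc n))) \<longlonglongrightarrow>
      integral {0<..} (\<lambda>t. cis \<phi> * G (of_real t * cis \<phi>))
       - integral {0<..} (\<lambda>t. cis (- \<phi>) * G (of_real t * cis (- \<phi>)))"
    using tendsto_diff [OF lim [of \<phi>] lim [of "-\<phi>"]] \<phi>
    unfolding D_def by (simp add: algebra_simps)
  moreover have "(\<lambda>n. D (r n) - D (1 / real (Suc n))) \<longlonglongrightarrow> 0 - 0"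
    by (intro tendsto_diff Dr D0)
  ultimately show ?thesis
    using LIMSEQ_unique by fastforce
qed

section \<open>The Clifford algebra and its complex slices\<close>

lemma bounded_linear_coords: "bounded_linear coords"
  by (rule bounded_linear_intro [where K = 1]) (simp_all add: norm_clifford_def)

lemma bounded_linear_coords_nth: "bounded_linear (\<lambda>a. coords a $ A)"
  using bounded_linear_compose [OF bounded_linear_vec_nth bounded_linear_coords] .

lemma coords_of_real: "coords (of_real r) = r *\<^sub>R axis {} 1"
  by (simp add: of_real_def one_clifford_def of_coords_inverse)

lemma coords_basis_elt: "coords (basis_elt i) = axis {i} 1"
  by (simp add: basis_elt_def of_coords_inverse)

lemma coords_sum: "coords (sum f S) = (\<Sum>x\<in>S. coords (f x))"
  by (rule linear_sum [OF bounded_linear.linear [OF bounded_linear_coords]])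

text \<open>The Euclidean norm is in general not submultiplicative for Clifford products. The
  constant is the number of pairs of blades, written as a sum of absolute values of signs.\<close>

lemma bounded_bilinear_lmult:
  "bounded_bilinear (lmult :: 'n::{finite,linorder} clifford \<Rightarrow> 'v::real_normed_vector ^ ('n set) \<Rightarrow> _)"
proof
  fix a b :: "'n clifford" and v w :: "'v ^ ('n set)" and r :: real
  show "lmult (a + b) v = lmult a v + lmult b v"
    by (simp add: vec_eq_iff lmult_nth algebra_simps sum.distrib)
  show "lmult a (v + w) = lmult a v + lmult a w"
    by (simp add: vec_eq_iff lmult_nth algebra_simps sum.distrib)
  show "lmult (r *\<^sub>R a) v = r *\<^sub>R lmult a v"
    by (simp add: vec_eq_iff lmult_nth scaleR_sum_right mult_ac)
  show "lmult a (r *\<^sub>R v) = r *\<^sub>R lmult a v"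
    by (simp add: vec_eq_iff lmult_nth scaleR_sum_right mult_ac)
  have axis: "norm (axis A x) = norm x" for A :: "'n set" and x :: 'v
    by (simp add: norm_vec_def L2_set_def axis_def if_distrib [where f = norm]
        if_distrib [where f = "\<lambda>x. x ^ 2"] cong: if_cong)
  have "norm (lmult a v) \<le> norm a * norm v * (\<Sum>A\<in>UNIV. \<Sum>B\<in>UNIV. \<bar>blade_sign A (B :: 'n set)\<bar>)"
    for a :: "'n clifford" and v :: "'v ^ ('n set)"
    unfolding lmult_def sum_distrib_left
  proof (rule sum_norm_le, rule sum_norm_le)
    fix A B :: "'n set"
    have "norm ((coords a $ A * blade_sign A B) *\<^sub>R axis (sym_diff A B) (v $ B))
        = norm (coords a $ A) * norm (v $ B) * \<bar>blade_sign A B\<bar>"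
      by (simp add: axis abs_mult mult_ac)
    also have "\<dots> \<le> norm a * norm v * \<bar>blade_sign A B\<bar>"
      unfolding norm_clifford_def
      by (intro mult_right_mono mult_mono Finite_Cartesian_Product.norm_nth_le) (auto simp flip: real_norm_def intro: Finite_Cartesian_Product.norm_nth_le)
    finally show "norm ((coords a $ A * blade_sign A B) *\<^sub>R axis (sym_diff A B) (v $ B))
        \<le> norm a * norm v * \<bar>blade_sign A B\<bar>" .
  qed
  then show "\<exists>K. \<forall>a v. norm (lmult a v :: 'v ^ ('n set)) \<le> norm (a :: 'n clifford) * norm v * K"
    by blast
qed

lemma bounded_bilinear_times_clifford:
  "bounded_bilinear ((*) :: 'n::{finite,linorder} clifford \<Rightarrow> 'n clifford \<Rightarrow> 'n clifford)"
proof
  obtain K where "\<And>a v. norm (lmult a v :: real ^ ('n set)) \<le> norm (a :: 'n clifford) * norm v * K"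
    using bounded_bilinear.bounded [OF bounded_bilinear_lmult] by metis
  then show "\<exists>K. \<forall>a b. norm (a * b) \<le> norm a * norm (b :: 'n clifford) * K"
    by (metis norm_clifford_def of_coords_inverse UNIV_I times_clifford_def)
qed (simp_all add: algebra_simps)

lemma lmult_of_real: "lmult (of_real r) v = r *\<^sub>R v"
  by (simp add: vec_eq_iff lmult_nth coords_of_real axis_def if_distrib [where f = "\<lambda>x. _ * x"]
      if_distrib [where f = "\<lambda>x. x * _"] if_distrib [where f = "\<lambda>x. x *\<^sub>R _"] cong: if_cong)

lemma lmult_mult: "lmult (a * b) v = lmult a (lmult b v)"
  by (simp add: times_clifford_def lmult_lmult)

text \<open>Reduces integrals of \<open>lmult (a t) v\<close> with fixed \<open>v\<close> to real
  integrals of the coordinates of \<open>a t\<close>.\<close>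

lemma lmult_eq_sum: "lmult a v = (\<Sum>A\<in>UNIV. (coords a $ A) *\<^sub>R lmult (of_coords (axis A 1)) v)"
proof -
  have "a = (\<Sum>A\<in>UNIV. (coords a $ A) *\<^sub>R of_coords (axis A 1))"
    by (rule coords_eqI) (simp add: coords_sum of_coords_inverse axis_def if_distrib [where f = "\<lambda>x. _ * x"] cong: if_cong)
  then have "lmult a v = lmult (\<Sum>A\<in>UNIV. (coords a $ A) *\<^sub>R of_coords (axis A 1)) v"
    by simp
  then show ?thesis
    by (simp add: bounded_bilinear.sum_left [OF bounded_bilinear_lmult]
        bounded_bilinear.scaleR_left [OF bounded_bilinear_lmult])
qed

lemma rmult_of_real: "rmult v (of_real r) = r *\<^sub>R v"
proof -
  have "rmult v (of_real r) = (\<Sum>B\<in>UNIV. r *\<^sub>R axis B (v $ B))"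
    unfolding rmult_def
    by (rule sum.cong) (simp_all add: coords_of_real axis_def [of "{}"] if_distrib [where f = "\<lambda>x. _ * x"]
        if_distrib [where f = "\<lambda>x. x * _"] if_distrib [where f = "\<lambda>x. x *\<^sub>R _"] cong: if_cong)
  also have "\<dots> = r *\<^sub>R v"
    by (simp add: vec_eq_iff axis_def if_distrib [where f = "\<lambda>x. _ *\<^sub>R x"] cong: if_cong)
  finally show ?thesis .
qed

lemma paravector_coords:
  assumes "s \<in> paravectors"
  shows "s = of_real (real_part s) + (\<Sum>i\<in>UNIV. (coords s $ {i}) *\<^sub>R basis_elt i)"
proof -
  obtain x0 x where s: "s = of_real x0 + (\<Sum>i\<in>UNIV. x i *\<^sub>R basis_elt i)"
    using assms by (auto simp: paravectors_def)
  have "real_part s = x0" "coords s $ {i} = x i" for i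
    by (simp_all add: s real_part_def coords_of_real coords_sum coords_basis_elt axis_def
        if_distrib [where f = "\<lambda>x. _ * x"] cong: if_cong)
  then show ?thesis using s by simp
qed

lemma conj_para_add: "conj_para (a + b) = conj_para a + conj_para b"
  by (simp add: conj_para_def real_part_def algebra_simps sum.distrib)

lemma conj_para_scaleR: "conj_para (r *\<^sub>R a) = r *\<^sub>R conj_para a"
  by (simp add: conj_para_def real_part_def scaleR_sum_right scaleR_diff_right of_real_def)

lemma add_conj_para:
  assumes "s \<in> paravectors"
  shows "s + conj_para s = of_real (2 * real_part s)"
proof -
  have "s + conj_para s = of_real (real_part s) + of_real (real_part s)"
    by (subst paravector_coords [OF assms]) (simp add: conj_para_def)
  then show ?thesis by (simp flip: of_real_add)
qed

lemma basis_elt_mult_add: "basis_elt i * basis_elt j + basis_elt j * basis_elt i = of_real (if i = j then - 2 else 0)"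
  by (cases "i = j") (simp_all add: basis_elt_sq basis_elt_anticommute [of i j])

text \<open>Doubling \<open>J * J\<close> and swapping the indices in one copy leaves
  anticommutators of generators, which vanish off the diagonal; the diagonal gives -2 times the
  squared norm of \<open>J\<close>.\<close>

lemma unit_sphere_sq:
  assumes "J \<in> unit_sphere"
  shows "J * J = - 1"
proof -
  define x where "x i = coords J $ {i}" for i
  have J: "J = (\<Sum>i\<in>UNIV. x i *\<^sub>R basis_elt i)" and nJ: "norm J = 1"
    using assms paravector_coords [of J] by (auto simp: unit_sphere_def x_def)
  have cJ: "coords J = (\<Sum>i\<in>UNIV. x i *\<^sub>R axis {i} 1)"
    by (subst J) (simp add: coords_sum coords_basis_elt)
  have "1 = inner (coords J) (coords J)"
    using nJ by (simp add: norm_clifford_def norm_eq_1)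
  also have "\<dots> = (\<Sum>i\<in>UNIV. x i * x i)"
    by (subst cJ) (simp add: inner_sum_left inner_axis' x_def)
  finally have 1: "(\<Sum>i\<in>UNIV. x i * x i) = 1" ..
  have JJ: "J * J = (\<Sum>i\<in>UNIV. \<Sum>j\<in>UNIV. (x i * x j) *\<^sub>R (basis_elt i * basis_elt j))"
    by (subst (1 2) J) (simp add: sum_product mult_ac)
  also have "\<dots> = (\<Sum>j\<in>UNIV. \<Sum>i\<in>UNIV. (x i * x j) *\<^sub>R (basis_elt i * basis_elt j))"
    by (rule sum.swap)
  finally have "J * J + J * J = (\<Sum>i\<in>UNIV. \<Sum>j\<in>UNIV. (x i * x j) *\<^sub>R (basis_elt i * basis_elt j + basis_elt j * basis_elt i))"
    using JJ by (simp add: sum.distrib scaleR_add_right mult.commute)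
  also have "\<dots> = (\<Sum>i\<in>UNIV. of_real (- 2 * (x i * x i)))"
    unfolding basis_elt_mult_add
    by (rule sum.cong) (simp_all add: scaleR_conv_of_real if_distrib [where f = of_real]
        if_distrib [where f = "\<lambda>x. _ * x"] mult_ac cong: if_cong)
  also have "\<dots> = of_real (- 2)"
    unfolding of_real_sum [symmetric] sum_distrib_left [symmetric] 1 by simp
  finally have "2 *\<^sub>R (J * J) = 2 *\<^sub>R (- 1)"
    by (simp add: scaleR_2 of_real_def)
  then show ?thesis by (simp only: scaleR_cancel_left) simp
qed

lemma conj_para_unit_sphere: "J \<in> unit_sphere \<Longrightarrow> conj_para J = - J"
  using add_conj_para [of J] by (simp add: unit_sphere_def add_eq_0_iff)

text \<open>For \<open>J\<close> in the unit sphere this is an isometric algebra isomorphism from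
  the complex numbers onto C_J; through it complex analysis reaches the slices.\<close>

definition embed :: "'n::{finite,linorder} clifford \<Rightarrow> complex \<Rightarrow> 'n clifford" where
  "embed J z = of_real (Re z) + Im z *\<^sub>R J"

lemma slice_pt_eq_embed: "slice_pt J (x, y) = embed J (Complex x y)"
  by (simp add: slice_pt_def embed_def)

lemma cexpJ_eq_embed: "cexpJ J \<psi> = embed J (cis \<psi>)"
  by (simp add: cexpJ_def embed_def)

lemma bounded_linear_embed: "bounded_linear (embed J)"
  unfolding embed_def of_real_def
  by (intro bounded_linear_add bounded_linear_compose [OF bounded_linear_scaleR_left]
      bounded_linear_Re bounded_linear_Im)

lemma real_part_embed: "J \<in> unit_sphere \<Longrightarrow> real_part (embed J z) = Re z"
  by (simp add: unit_sphere_def real_part_def embed_def coords_of_real axis_def)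

lemma embed_in_paravectors:
  assumes "J \<in> unit_sphere"
  shows "embed J z \<in> paravectors"
proof -
  have "J = (\<Sum>i\<in>UNIV. (coords J $ {i}) *\<^sub>R basis_elt i)"
    using assms paravector_coords [of J] by (simp add: unit_sphere_def)
  then have "embed J z = of_real (Re z) + (\<Sum>i\<in>UNIV. (Im z * (coords J $ {i})) *\<^sub>R basis_elt i)"
    unfolding embed_def by (metis (no_types, lifting) scaleR_scaleR scaleR_sum_right sum.cong)
  then show ?thesis
    unfolding paravectors_def
    by (intro CollectI exI [of _ "Re z"] exI [of _ "\<lambda>i. Im z * (coords J $ {i})"]) simp
qed

lemma conj_para_embed:
  assumes "J \<in> unit_sphere"
  shows "conj_para (embed J z) = embed J (cnj z)"
proof -
  have "conj_para (of_real r) = (of_real r :: 'a clifford)" for r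
    by (simp add: conj_para_def real_part_def coords_of_real axis_def)
  then show ?thesis
    using assms by (simp add: embed_def conj_para_add conj_para_scaleR conj_para_unit_sphere)
qed

lemma norm_embed:
  assumes "J \<in> unit_sphere"
  shows "norm (embed J z) = cmod z"
proof -
  have J: "inner (coords J) (coords J) = 1" "inner (axis {} 1) (coords J) = 0" "inner (coords J) (axis {} 1) = 0"
    using assms by (simp_all add: unit_sphere_def norm_clifford_def norm_eq_1 real_part_def inner_axis inner_axis')
  have "inner (axis {} 1) (axis {} 1 :: real ^ 'a set) = 1"
    by (simp add: inner_axis axis_nth)
  with J have "inner (coords (embed J z)) (coords (embed J z)) = (Re z)\<^sup>2 + (Im z)\<^sup>2"
    by (simp add: embed_def coords_of_real inner_add_left inner_add_right power2_eq_square)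
  then show ?thesis
    by (simp add: norm_clifford_def norm_eq_sqrt_inner [of "coords _"] cmod_def)
qed

lemma embed_mult:
  assumes "J \<in> unit_sphere"
  shows "embed J (z * w) = embed J z * embed J w"
  by (simp add: embed_def of_real_def algebra_simps unit_sphere_sq [OF assms])

lemma embed_one [simp]: "embed J 1 = 1"
  by (simp add: embed_def)

lemma embed_power: "J \<in> unit_sphere \<Longrightarrow> embed J (z ^ k) = embed J z ^ k"
  by (induction k) (simp_all add: embed_mult)

lemma embed_of_real [simp]: "embed J (of_real r) = of_real r"
  by (simp add: embed_def)

text \<open>The real functional \<open>u \<mapsto> u\<^sub>C\<close> made complex linear for the left multiplication by \<open>\<complex>\<^sub>J\<close>.\<close>

definition slice_functional :: "'n::{finite,linorder} clifford \<Rightarrow> 'n set \<Rightarrow> 'n clifford \<Rightarrow> complex" where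
  "slice_functional J C u = Complex (coords u $ C) (- coords (J * u) $ C)"

lemma bounded_linear_slice_functional: "bounded_linear (slice_functional J C)"
proof -
  have "bounded_linear (\<lambda>u. coords (J * u) $ C)"
    by (rule bounded_linear_compose [OF bounded_linear_coords_nth
          bounded_bilinear.bounded_linear_right [OF bounded_bilinear_times_clifford]])
  then have "bounded_linear (\<lambda>u. of_real (coords u $ C) - \<i> * of_real (coords (J * u) $ C))"
    by (intro bounded_linear_sub bounded_linear_const_mult bounded_linear_compose [OF bounded_linear_of_real]
        bounded_linear_coords_nth)
  then show ?thesis
    by (simp add: slice_functional_def [abs_def] Complex_eq)
qed

text \<open>Multiplying by \<open>J\<close> twice gives -1, which makes the two real coordinates
  transform like a complex number. The real part still is the coordinate at \<open>C\<close>, so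
  nothing is lost by testing with these functionals.\<close>

lemma slice_functional_embed_mult:
  assumes "J \<in> unit_sphere"
  shows "slice_functional J C (embed J z * u) = z * slice_functional J C u"
proof -
  have 1: "J * (J * u) = - u"
    by (simp add: mult.assoc [symmetric] unit_sphere_sq [OF assms])
  have 2: "embed J z * u = Re z *\<^sub>R u + Im z *\<^sub>R (J * u)"
    by (simp add: embed_def distrib_right scaleR_conv_of_real mult.assoc)
  then have 3: "J * (embed J z * u) = Re z *\<^sub>R (J * u) - Im z *\<^sub>R u"
    by (simp add: distrib_left 1)
  show ?thesis
    unfolding slice_functional_def 3 unfolding 2 by (simp add: complex_eq_iff)
qed

section \<open>The S-resolvent\<close>

text \<open>Real scalars act as right multiplication by real Clifford numbers, so right linearity
  contains real linearity.\<close>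

lemma right_linear_op_scaleR:
  "right_linear_op T \<Longrightarrow> T u = Some x \<Longrightarrow> T (r *\<^sub>R u) = Some (r *\<^sub>R x)"
  unfolding right_linear_op_def by (metis rmult_of_real)

lemma right_linear_op_add:
  "right_linear_op T \<Longrightarrow> T u = Some x \<Longrightarrow> T v = Some y \<Longrightarrow> T (u + v) = Some (x + y)"
  by (simp add: right_linear_op_def)

lemma right_linear_op_diff:
  "right_linear_op T \<Longrightarrow> T u = Some x \<Longrightarrow> T v = Some y \<Longrightarrow> T (u - v) = Some (x - y)"
  using right_linear_op_add [of T u x "- v" "- y"] right_linear_op_scaleR [of T v y "- 1"] by simp

lemma right_linear_op_zero: "right_linear_op T \<Longrightarrow> T 0 = Some 0"
  using right_linear_op_scaleR [of T 0 _ 0] by (auto simp: right_linear_op_def)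

lemma subspace_graph: "right_linear_op T \<Longrightarrow> subspace {(u, x). T u = Some x}"
  by (auto simp: subspace_def zero_prod_def right_linear_op_zero right_linear_op_add right_linear_op_scaleR)

lemma Q_op_eq_Some:
  "Q_op T s u = Some v \<longleftrightarrow>
     (\<exists>x y. T u = Some x \<and> T x = Some y \<and> v = y - (2 * real_part s) *\<^sub>R x + (norm s)\<^sup>2 *\<^sub>R u)"
  by (auto simp: Q_op_def numeral_2_eq_2 dom_def map_comp_def split: option.splits)

lemma Q_inv_eq_iff:
  assumes "s \<in> S_resolvent_set T"
  shows "Q_inv T s v = u \<longleftrightarrow> Q_op T s u = Some v"
proof -
  obtain B where B: "is_bounded_inverse (Q_op T s) B"
    using assms by (auto simp: S_resolvent_set_def)
  have "Q_inv T s = B"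
    unfolding Q_inv_def
  proof (rule the_equality [of "is_bounded_inverse (Q_op T s)", OF B])
    fix B' assume "is_bounded_inverse (Q_op T s) B'"
    then show "B' = B"
      using B by (intro blinfun_eqI) (metis is_bounded_inverse_def)
  qed
  then show ?thesis
    using B by (simp add: is_bounded_inverse_def)
qed

lemma Q_inv_ranE:
  assumes "s \<in> S_resolvent_set T"
  obtains x y where "T (Q_inv T s v) = Some x" "T x = Some y"
    "v = y - (2 * real_part s) *\<^sub>R x + (norm s)\<^sup>2 *\<^sub>R Q_inv T s v"
  using Q_inv_eq_iff [OF assms, of v "Q_inv T s v"] by (auto simp: Q_op_eq_Some)

text \<open>The range of \<open>Q_inv\<close> lies in the domain of T^2, so the \<open>the\<close>
  in \<open>S_resolvent\<close> never meets \<open>None\<close> on the resolvent set.\<close>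

lemma T_Q_inv:
  assumes "s \<in> S_resolvent_set T"
  shows "T (Q_inv T s v) = Some (the (T (Q_inv T s v)))"
  by (rule Q_inv_ranE [OF assms, of v]) (simp only: option.sel)

lemma linear_T_Q_inv:
  assumes "right_linear_op T" "s \<in> S_resolvent_set T"
  shows "linear (\<lambda>v. the (T (Q_inv T s v)))"
proof
  fix v w r
  show "the (T (Q_inv T s (v + w))) = the (T (Q_inv T s v)) + the (T (Q_inv T s w))"
    using right_linear_op_add [OF assms(1) T_Q_inv T_Q_inv, OF assms(2,2)] by (simp add: blinfun.add_right)
  show "the (T (Q_inv T s (r *\<^sub>R v))) = r *\<^sub>R the (T (Q_inv T s v))"
    using right_linear_op_scaleR [OF assms(1) T_Q_inv, OF assms(2)] by (simp add: blinfun.scaleR_right)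
qed

text \<open>Write Q for Q_s[T] and y for T^2 Q^-1 v. Then S(s) s v - T S(s) v equals |s|^2 Q^-1 v -
  T Q^-1 (s + conj(s)) v + y. The real number s + conj(s) passes through T Q^-1, and what remains is
  Q applied to Q^-1 v, that is v.\<close>

lemma S_resolvent_equation:
  assumes T: "right_linear_op T" and J: "J \<in> unit_sphere" and s: "embed J z \<in> S_resolvent_set T"
  shows "T (S_resolvent T (embed J z) v)
    = Some (S_resolvent T (embed J z) (lmult (embed J z) v) - v)"
proof -
  let ?s = "embed J z"
  let ?U = "\<lambda>v. the (T (Q_inv T ?s v))"
  interpret L: bounded_bilinear "lmult :: 'b clifford \<Rightarrow> 'a ^ ('b set) \<Rightarrow> _"
    by (rule bounded_bilinear_lmult)
  obtain x y where x: "T (Q_inv T ?s v) = Some x" and y: "T x = Some y"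
    and v: "v = y - (2 * real_part ?s) *\<^sub>R x + (norm ?s)\<^sup>2 *\<^sub>R Q_inv T ?s v"
    using s by (rule Q_inv_ranE)
  have cs: "lmult (conj_para ?s) (lmult ?s v) = (norm ?s)\<^sup>2 *\<^sub>R v"
  proof -
    have "conj_para ?s * ?s = of_real ((norm ?s)\<^sup>2)"
      using J by (simp add: conj_para_embed norm_embed complex_norm_square [symmetric] mult.commute
          flip: embed_mult embed_of_real [of J])
    then show ?thesis by (metis lmult_mult lmult_of_real)
  qed
  have add: "lmult ?s v + lmult (conj_para ?s) v = (2 * real_part ?s) *\<^sub>R v"
    using add_conj_para [OF embed_in_paravectors [OF J, of z]] by (metis L.add_left lmult_of_real)
  have sum: "?U (lmult ?s v) + ?U (lmult (conj_para ?s) v) = (2 * real_part ?s) *\<^sub>R x"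
    using linear_add [OF linear_T_Q_inv [OF T s], of "lmult ?s v" "lmult (conj_para ?s) v"]
      linear_scale [OF linear_T_Q_inv [OF T s], of _ v]
    by (simp only: add x option.sel)
  have "T (S_resolvent T ?s v) = Some (?U (lmult (conj_para ?s) v) - y)"
    unfolding S_resolvent_def using right_linear_op_diff [OF T T_Q_inv [OF s] y] x by simp
  moreover have S: "S_resolvent T ?s (lmult ?s v) = (norm ?s)\<^sup>2 *\<^sub>R Q_inv T ?s v - ?U (lmult ?s v)"
    unfolding S_resolvent_def cs by (simp add: blinfun.scaleR_right)
  moreover have "(norm ?s)\<^sup>2 *\<^sub>R Q_inv T ?s v - ?U (lmult ?s v) - v
      = (norm ?s)\<^sup>2 *\<^sub>R Q_inv T ?s v - ?U (lmult ?s v)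
        - (y - (?U (lmult ?s v) + ?U (lmult (conj_para ?s) v)) + (norm ?s)\<^sup>2 *\<^sub>R Q_inv T ?s v)"
    unfolding sum by (rule arg_cong [OF v])
  ultimately show ?thesis by simp
qed

text \<open>No bound on \<open>R s\<close> is given in advance. Once |B s| < 1/2, the relation
  itself yields |R s| \<le> |R0| + |R s| / 2, hence |R s| \<le> 2 |R0| and |R s - R0| \<le> 2 |R0|
  |B s|.\<close>

lemma tendsto_blinfun_perturbation:
  fixes R :: "'s \<Rightarrow> 'a::real_normed_vector \<Rightarrow>\<^sub>L 'b::real_normed_vector"
  assumes eq: "\<forall>\<^sub>F s in F. R s + (R s o\<^sub>L B s) = R0" and B: "(B \<longlongrightarrow> 0) F"
  shows "(R \<longlongrightarrow> R0) F"
proof -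
  have "\<forall>\<^sub>F s in F. norm (B s) < 1 / 2"
    using order_tendstoD(2) [OF tendsto_norm [OF B], of "1 / 2"] by simp
  with eq have "\<forall>\<^sub>F s in F. norm (R s - R0) \<le> 2 * norm R0 * norm (B s)"
  proof eventually_elim
    case (elim s)
    have R: "R s = R0 - (R s o\<^sub>L B s)"
      using elim(1) by (metis add_diff_cancel_right')
    have le: "norm (R s o\<^sub>L B s) \<le> norm (R s) * norm (B s)" by (rule norm_blinfun_compose)
    also have "\<dots> \<le> norm (R s) * (1 / 2)" using elim by (intro mult_left_mono) auto
    finally have "norm (R s) \<le> norm R0 + norm (R s) * (1 / 2)"
      using norm_triangle_ineq4 [of R0 "R s o\<^sub>L B s"] R by simp
    then have "norm (R s) * norm (B s) \<le> (2 * norm R0) * norm (B s)"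
      by (intro mult_right_mono) auto
    moreover have "R s - R0 = - (R s o\<^sub>L B s)"
      using elim(1) by (simp add: algebra_simps)
    ultimately show ?case using le by (simp only: norm_minus_cancel)
  qed
  moreover have "((\<lambda>s. 2 * norm R0 * norm (B s)) \<longlongrightarrow> 0) F"
    by (rule tendsto_mult_right_zero [OF tendsto_norm_zero [OF B]])
  ultimately have "((\<lambda>s. R s - R0) \<longlongrightarrow> 0) F"
    by (rule Lim_null_comparison)
  then show ?thesis by (simp add: LIM_zero_iff)
qed

text \<open>Q_s depends on s only through its real part and norm, so Q_s Q_s0^-1 = 1 +
  \<open>B s\<close> with \<open>B s\<close> tending to 0 at s0, and therefore Q_s^-1 (1 +
  \<open>B s\<close>) = Q_s0^-1. Applying \<open>T\<close> gives the same relation for T Q_s^-1, so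
  one perturbation settles both claims.\<close>

lemma
  fixes T :: "('v::banach, 'n::{finite,linorder}) clifford_op"
  assumes T: "right_linear_op T" and A: "A \<subseteq> S_resolvent_set T"
    and bl: "\<And>s. s \<in> A \<Longrightarrow> bounded_linear (\<lambda>v. the (T (Q_inv T s v)))"
  shows continuous_on_Q_inv: "continuous_on A (Q_inv T)"
    and continuous_on_T_Q_inv: "continuous_on A (\<lambda>s. Blinfun (\<lambda>v. the (T (Q_inv T s v))))"
proof -
  let ?U = "\<lambda>s. Blinfun (\<lambda>v. the (T (Q_inv T s v)))"
  have U: "?U s v = the (T (Q_inv T s v))" if "s \<in> A" for s v
    using bl [OF that] by (simp add: bounded_linear_Blinfun_apply)
  have "(Q_inv T \<longlongrightarrow> Q_inv T s0) (at s0 within A) \<and> (?U \<longlongrightarrow> ?U s0) (at s0 within A)"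
    if s0: "s0 \<in> A" for s0
  proof -
    define B where "B s = ((norm s)\<^sup>2 - (norm s0)\<^sup>2) *\<^sub>R Q_inv T s0 - (2 * (real_part s - real_part s0)) *\<^sub>R ?U s0"
      for s :: "'n clifford"
    have eq: "Q_inv T s v + Q_inv T s (B s v) = Q_inv T s0 v" if s: "s \<in> A" for s v
    proof -
      obtain x y where xy: "T (Q_inv T s0 v) = Some x" "T x = Some y"
        "v = y - (2 * real_part s0) *\<^sub>R x + (norm s0)\<^sup>2 *\<^sub>R Q_inv T s0 v"
        using Q_inv_ranE [of s0 T v] s0 A by blast
      have Bv: "B s v = ((norm s)\<^sup>2 - (norm s0)\<^sup>2) *\<^sub>R Q_inv T s0 v - (2 * (real_part s - real_part s0)) *\<^sub>R x"
        by (simp add: B_def U [OF s0] blinfun.bilinear_simps xy(1))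
      have "v + B s v = y - (2 * real_part s) *\<^sub>R x + (norm s)\<^sup>2 *\<^sub>R Q_inv T s0 v"
        unfolding Bv using xy(3) [THEN arg_cong, of "\<lambda>w. w + _"] by (rule trans) (simp add: algebra_simps)
      then have "Q_op T s (Q_inv T s0 v) = Some (v + B s v)"
        unfolding Q_op_eq_Some using xy(1,2) by blast
      then show ?thesis
        using Q_inv_eq_iff [of s T "v + B s v" "Q_inv T s0 v"] s A by (auto simp: blinfun.add_right)
    qed
    have B: "(B \<longlongrightarrow> 0) (at s0 within A)"
    proof -
      have "((\<lambda>s. real_part s) \<longlongrightarrow> real_part s0) (at s0 within A)"
        unfolding real_part_def
        by (rule bounded_linear.tendsto [OF bounded_linear_coords_nth]) (rule tendsto_ident_at)
      then have "(B \<longlongrightarrow> ((norm s0)\<^sup>2 - (norm s0)\<^sup>2) *\<^sub>R Q_inv T s0 - (2 * (real_part s0 - real_part s0)) *\<^sub>R ?U s0) (at s0 within A)"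
        unfolding B_def by (intro tendsto_intros)
      then show ?thesis by simp
    qed
    have evA: "\<forall>\<^sub>F s in at s0 within A. s \<in> A"
      by (simp add: eventually_at_filter)
    have "\<forall>\<^sub>F s in at s0 within A. Q_inv T s + (Q_inv T s o\<^sub>L B s) = Q_inv T s0"
      using evA by eventually_elim (rule blinfun_eqI, simp add: blinfun.add_left eq)
    moreover have "\<forall>\<^sub>F s in at s0 within A. ?U s + (?U s o\<^sub>L B s) = ?U s0"
      using evA
    proof eventually_elim
      case (elim s)
      show ?case
      proof (rule blinfun_eqI)
        fix v
        have "the (T (Q_inv T s (v + B s v))) = the (T (Q_inv T s0 v))"
          using eq [OF elim, of v] by (simp add: blinfun.add_right)
        then show "(?U s + (?U s o\<^sub>L B s)) v = ?U s0 v"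
          using linear_add [OF bounded_linear.linear [OF bl [OF elim]]]
          by (simp add: blinfun.add_left U elim s0)
      qed
    qed
    ultimately show ?thesis
      by (intro conjI tendsto_blinfun_perturbation [OF _ B])
  qed
  then show "continuous_on A (Q_inv T)" "continuous_on A ?U"
    by (auto simp: continuous_on)
qed

text \<open>The bound on the S-resolvent also controls T Q_s^-1, since T Q_s^-1 v = Q_s^-1 conj(s) v
  - S(s) v.\<close>

lemma bounded_linear_S_resolvent:
  assumes T: "right_linear_op T" and s: "s \<in> S_resolvent_set T"
    and bd: "\<And>v. norm (S_resolvent T s v) \<le> K * norm v"
  shows "bounded_linear (S_resolvent T s)" "bounded_linear (\<lambda>v. the (T (Q_inv T s v)))"
proof -
  note L = bounded_bilinear.bounded_linear_right [OF bounded_bilinear_lmult]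
  have Q: "bounded_linear (\<lambda>v. Q_inv T s (lmult (conj_para s) v))"
    by (rule bounded_linear_compose [OF blinfun.bounded_linear_right L])
  have "linear (S_resolvent T s)"
    unfolding S_resolvent_def [abs_def]
    using bounded_linear.linear [OF Q] linear_T_Q_inv [OF T s] by (rule linear_compose_sub)
  then show S: "bounded_linear (S_resolvent T s)"
    using bd by (intro bounded_linear_intro [of _ K]) (auto simp: linear_add linear_scale mult.commute)
  from bounded_linear_sub [OF Q S] show "bounded_linear (\<lambda>v. the (T (Q_inv T s v)))"
    by (simp add: S_resolvent_def)
qed

text \<open>Norm continuity is what \<open>integrable_on_greaterThan_dominated\<close> asks for in
  the space of bounded operators. Splitting off T Q_s^-1 presents the operator as a combination of
  products of norm continuous factors.\<close>

lemma continuous_on_S_resolvent: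
  fixes T :: "('v::banach, 'n::{finite,linorder}) clifford_op"
  assumes T: "right_linear_op T" and A: "A \<subseteq> S_resolvent_set T"
    and bd: "\<And>s. s \<in> A \<Longrightarrow> \<exists>K. \<forall>v. norm (S_resolvent T s v) \<le> K * norm v"
    and g: "continuous_on X g" "g ` X \<subseteq> A" and a: "continuous_on X a"
  shows "continuous_on X (\<lambda>t. Blinfun (\<lambda>v. S_resolvent T (g t) (lmult (a t) v)))"
proof -
  interpret L: bounded_bilinear "lmult :: 'n clifford \<Rightarrow> 'v ^ ('n set) \<Rightarrow> _"
    by (rule bounded_bilinear_lmult)
  let ?L = "L.prod_right"
  let ?U = "\<lambda>s. Blinfun (\<lambda>v. the (T (Q_inv T s v)))"
  have bl: "bounded_linear (\<lambda>v. the (T (Q_inv T s v)))" "bounded_linear (S_resolvent T s)" if "s \<in> A" for s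
    using bd [OF that] bounded_linear_S_resolvent [OF T, of s] that A by blast+
  have conj: "bounded_linear (conj_para :: 'n clifford \<Rightarrow> _)"
    unfolding conj_para_def [abs_def] real_part_def of_real_def
    by (intro bounded_linear_sub bounded_linear_compose [OF bounded_linear_scaleR_left] bounded_linear_sum
      bounded_linear_coords_nth)
  have "continuous_on X (\<lambda>t. (Q_inv T (g t) o\<^sub>L ?L (conj_para (g t) * a t)) - (?U (g t) o\<^sub>L ?L (a t)))"
    by (intro continuous_on_diff bounded_bilinear.continuous_on [OF bounded_bilinear_blinfun_compose]
        bounded_linear.continuous_on [OF L.bounded_linear_prod_right]
        bounded_bilinear.continuous_on [OF bounded_bilinear_times_clifford]
        bounded_linear.continuous_on [OF conj] g(1) a
        continuous_on_compose2 [OF continuous_on_Q_inv [OF T A bl(1)] g]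
        continuous_on_compose2 [OF continuous_on_T_Q_inv [OF T A bl(1)] g])
  then show ?thesis
  proof (rule continuous_on_eq)
    fix t assume "t \<in> X"
    then have t: "g t \<in> A" using g(2) by blast
    have "bounded_linear (\<lambda>v. S_resolvent T (g t) (lmult (a t) v))"
      by (rule bounded_linear_compose [OF bl(2) [OF t] L.bounded_linear_right])
    then show "(Q_inv T (g t) o\<^sub>L ?L (conj_para (g t) * a t)) - (?U (g t) o\<^sub>L ?L (a t))
      = Blinfun (\<lambda>v. S_resolvent T (g t) (lmult (a t) v))"
      by (intro blinfun_eqI)
        (simp add: bounded_linear_Blinfun_apply blinfun.diff_left S_resolvent_def lmult_mult bl [OF t])
  qed
qed

section \<open>Slice hyperholomorphic functions along rays\<close>

text \<open>For \<open>0 < \<theta> < pi / 2\<close> the preimage of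
  \<open>bisector \<theta>\<close> under \<open>embed J\<close>, stated without angles so that
  openness is immediate.\<close>

definition double_sector :: "real \<Rightarrow> complex set" where
  "double_sector \<theta> = {z. \<bar>Im z\<bar> < tan \<theta> * \<bar>Re z\<bar>}"

lemma open_double_sector: "open (double_sector \<theta>)"
  unfolding double_sector_def by (intro open_Collect_less continuous_intros)

lemma mult_sign_in_double_sector:
  "\<epsilon> \<in> {1, -1} \<Longrightarrow> z \<in> sector \<theta> \<Longrightarrow> 0 < tan \<theta> \<Longrightarrow> of_real \<epsilon> * z \<in> double_sector \<theta>"
  by (auto simp: sector_def double_sector_def intro: less_le_trans mult_left_mono)

lemma embed_in_bisector:
  assumes J: "J \<in> unit_sphere" and \<theta>: "0 < \<theta>" "\<theta> < pi / 2" and z: "z \<in> double_sector \<theta>"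
  shows "embed J z \<in> bisector \<theta>"
proof -
  have Re: "Re z \<noteq> 0" using z by (auto simp: double_sector_def)
  \<comment> \<open>The slope determines the argument only up to sign of z: \<open>\<psi>\<close> is
    the argument of z or of -z, and the second case needs \<open>pi + \<psi>\<close>.
    \<open>r\<close> is the modulus, as |Re z| = |z| cos \<psi>.\<close>
  define \<psi> where "\<psi> = arctan (Im z / Re z)"
  define r where "r = \<bar>Re z\<bar> / cos \<psi>"
  have c: "0 < cos \<psi>" unfolding \<psi>_def using arctan_bounded by (intro cos_gt_zero_pi) auto
  have "\<bar>Im z / Re z\<bar> < tan \<theta>"
    using z Re by (simp add: double_sector_def abs_divide field_simps)
  then have "Im z / Re z < tan \<theta>" "tan (- \<theta>) < Im z / Re z"
    unfolding abs_less_iff tan_minus by linarith+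
  then have "arctan (Im z / Re z) < arctan (tan \<theta>)" "arctan (tan (- \<theta>)) < arctan (Im z / Re z)"
    by (simp_all only: arctan_less_iff)
  then have \<psi>: "\<psi> < \<theta>" "- \<theta> < \<psi>"
    using \<theta> by (simp_all add: \<psi>_def arctan_tan del: tan_minus)
  have "sin \<psi> = tan \<psi> * cos \<psi>" using c by (simp add: tan_def)
  then have s: "sin \<psi> * Re z = Im z * cos \<psi>"
    using Re by (simp add: \<psi>_def tan_arctan)
  have r: "0 < r" using c Re by (simp add: r_def)
  show ?thesis
  proof (cases "Re z > 0")
    case True
    have "embed J z = r *\<^sub>R cexpJ J \<psi>"
      using True c s by (simp add: embed_def cexpJ_def r_def scaleR_conv_of_real distrib_left field_simps
          flip: of_real_mult mult.assoc)
    moreover have "\<psi> \<in> angle_set \<theta>"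
      using \<psi> by (simp add: angle_set_def)
    ultimately show ?thesis
      unfolding bisector_def using r J by blast
  next
    case False
    have "embed J z = r *\<^sub>R cexpJ J (pi + \<psi>)"
      using False c s by (simp add: embed_def cexpJ_def r_def scaleR_conv_of_real distrib_left field_simps
          flip: of_real_mult mult.assoc)
    moreover have "pi + \<psi> \<in> angle_set \<theta>"
      using \<psi> by (simp add: angle_set_def)
    ultimately show ?thesis
      unfolding bisector_def using r J by blast
  qed
qed

text \<open>An inequality without angles passes to the closure in its weak form. Points at angle
  exactly \<phi> attain equality with \<open>tan \<phi>\<close>, which excludes them from
  \<open>bisector \<phi>\<close> and from the closure of a smaller one.\<close>

lemma bisector_imag_less:
  assumes \<theta>: "\<theta> < pi / 2" and s: "s \<in> bisector \<theta>"
  shows "norm (s - of_real (real_part s)) < tan \<theta> * \<bar>real_part s\<bar>"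
proof -
  obtain r J \<psi> where r: "0 < r" and J: "J \<in> unit_sphere" and \<psi>: "\<psi> \<in> angle_set \<theta>"
    and s: "s = r *\<^sub>R cexpJ J \<psi>"
    using s by (auto simp: bisector_def)
  have s': "s = embed J (of_real r * cis \<psi>)"
    by (simp add: s cexpJ_def embed_def scaleR_conv_of_real distrib_left flip: mult.assoc)
  have "\<bar>sin \<psi>\<bar> < tan \<theta> * \<bar>cos \<psi>\<bar>"
  proof (cases "\<psi> \<in> {- \<theta> <..< \<theta>}")
    case True
    then have "\<bar>sin \<psi>\<bar> < tan \<theta> * cos \<psi>" and "0 < cos \<psi>"
      using \<theta> by (auto intro!: abs_sin_less_tan_cos cos_gt_zero_pi)
    then show ?thesis by simp
  next
    case False
    then have \<psi>': "\<bar>\<psi> - pi\<bar> < \<theta>" using \<psi> by (auto simp: angle_set_def)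
    have "\<bar>sin (\<psi> - pi)\<bar> < tan \<theta> * cos (\<psi> - pi)"
      using \<theta> \<psi>' by (rule abs_sin_less_tan_cos)
    moreover have "0 < cos (\<psi> - pi)"
      using \<theta> \<psi>' by (intro cos_gt_zero_pi) linarith+
    ultimately show ?thesis by (simp add: sin_diff cos_diff)
  qed
  then have "r * \<bar>sin \<psi>\<bar> < r * (tan \<theta> * \<bar>cos \<psi>\<bar>)"
    using r by (rule mult_strict_left_mono)
  moreover have re: "real_part s = r * cos \<psi>"
    by (simp add: s' real_part_embed [OF J])
  moreover have "s - of_real (real_part s) = (r * sin \<psi>) *\<^sub>R J"
    unfolding re by (simp add: s' embed_def)
  then have "norm (s - of_real (real_part s)) = r * \<bar>sin \<psi>\<bar>" "\<bar>real_part s\<bar> = r * \<bar>cos \<psi>\<bar>"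
    using J r by (simp_all add: re unit_sphere_def abs_mult)
  ultimately show ?thesis by (simp add: mult_ac)
qed

lemma closure_bisector_imag_le:
  assumes \<theta>: "\<theta> < pi / 2" and s: "s \<in> closure (bisector \<theta>)"
  shows "norm (s - of_real (real_part s)) \<le> tan \<theta> * \<bar>real_part s\<bar>"
proof -
  have cont: "continuous_on UNIV (real_part :: 'a clifford \<Rightarrow> real)"
    unfolding real_part_def [abs_def] by (rule bounded_linear.continuous_on [OF bounded_linear_coords_nth continuous_on_id])
  have "closed {s :: 'a clifford. norm (s - of_real (real_part s)) \<le> tan \<theta> * \<bar>real_part s\<bar>}"
    unfolding of_real_def by (intro closed_Collect_le continuous_intros cont)
  moreover have "bisector \<theta> \<subseteq> {s :: 'a clifford. norm (s - of_real (real_part s)) \<le> tan \<theta> * \<bar>real_part s\<bar>}"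
    using bisector_imag_less [OF \<theta>] by force
  ultimately have "closure (bisector \<theta>) \<subseteq> {s :: 'a clifford. norm (s - of_real (real_part s)) \<le> tan \<theta> * \<bar>real_part s\<bar>}"
    by (rule closure_minimal [rotated])
  with s show ?thesis by auto
qed

text \<open>The Cauchy-Riemann equations turn the real derivative of f0 + J f1 in direction h into
  \<open>embed J h\<close> times its value in direction 1, with the complex factor on the left. A
  functional that is complex linear for left multiplication then has a complex derivative.\<close>

lemma slice_hyperholomorphic_holomorphic:
  assumes f: "slice_hyperholomorphic U f" and J: "J \<in> unit_sphere" and W: "open W"
    and WU: "\<And>z. z \<in> W \<Longrightarrow> (Re z, Im z) \<in> slice_domain U"
  shows "continuous_on W (\<lambda>z. f (embed J z))"
    and "(\<lambda>z. slice_functional J C (f (embed J z))) holomorphic_on W"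
proof -
  obtain f0 f1 D0 D1 where D0: "\<And>z. z \<in> slice_domain U \<Longrightarrow> (f0 has_derivative blinfun_apply (D0 z)) (at z)"
    and D1: "\<And>z. z \<in> slice_domain U \<Longrightarrow> (f1 has_derivative blinfun_apply (D1 z)) (at z)"
    and eq: "\<And>z. z \<in> slice_domain U \<Longrightarrow> f (slice_pt J z) = f0 z + J * f1 z"
    and CR: "\<And>z. z \<in> slice_domain U \<Longrightarrow> D0 z (1, 0) = D1 z (0, 1)"
      "\<And>z. z \<in> slice_domain U \<Longrightarrow> D0 z (0, 1) = - D1 z (1, 0)"
    using f J unfolding slice_hyperholomorphic_def by blast
  let ?d = "\<lambda>z. D0 (Re z, Im z) (1, 0) + J * D1 (Re z, Im z) (1, 0)"
  have der: "((\<lambda>z. f (embed J z)) has_derivative (\<lambda>h. embed J h * ?d z)) (at z)" if z: "z \<in> W" for z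
  proof -
    note zU = WU [OF z]
    have P: "((\<lambda>z. (Re z, Im z)) has_derivative (\<lambda>h. (Re h, Im h))) (at z)"
      by (intro has_derivative_Pair bounded_linear.has_derivative [OF bounded_linear_Re]
          bounded_linear.has_derivative [OF bounded_linear_Im] has_derivative_ident)
    have "((\<lambda>z. f0 (Re z, Im z) + J * f1 (Re z, Im z)) has_derivative
        (\<lambda>h. D0 (Re z, Im z) (Re h, Im h) + J * D1 (Re z, Im z) (Re h, Im h))) (at z)"
      by (intro has_derivative_add has_derivative_compose [OF P D0 [OF zU]]
          bounded_linear.has_derivative [OF bounded_bilinear.bounded_linear_right [OF bounded_bilinear_times_clifford]]
          has_derivative_compose [OF P D1 [OF zU]])
    moreover have "D0 (Re z, Im z) (Re h, Im h) + J * D1 (Re z, Im z) (Re h, Im h) = embed J h * ?d z" for h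
    proof -
      have h: "(Re h, Im h) = Re h *\<^sub>R (1, 0) + Im h *\<^sub>R (0, 1)" by simp
      have JJ: "J * (J * x) = - x" for x
        by (simp add: mult.assoc [symmetric] unit_sphere_sq [OF J])
      show ?thesis
        unfolding h blinfun.add_right blinfun.scaleR_right CR(2) [OF zU] CR(1) [OF zU, symmetric]
        by (simp add: embed_def of_real_def algebra_simps JJ)
    qed
    ultimately have "((\<lambda>z. f0 (Re z, Im z) + J * f1 (Re z, Im z)) has_derivative (\<lambda>h. embed J h * ?d z)) (at z)"
      by simp
    then show ?thesis
    proof (rule has_derivative_transform_within_open [OF _ W z])
      fix y assume "y \<in> W"
      then show "f0 (Re y, Im y) + J * f1 (Re y, Im y) = f (embed J y)"
        using eq [OF WU] by (simp add: slice_pt_eq_embed)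
    qed
  qed
  show "continuous_on W (\<lambda>z. f (embed J z))"
    using der by (intro continuous_at_imp_continuous_on ballI has_derivative_continuous)
  have "((\<lambda>z. slice_functional J C (f (embed J z))) has_field_derivative slice_functional J C (?d z)) (at z)"
    if "z \<in> W" for z
    unfolding has_field_derivative_def
    by (rule has_derivative_eq_rhs [OF bounded_linear.has_derivative [OF bounded_linear_slice_functional der [OF that]]])
      (simp add: slice_functional_embed_mult [OF J] fun_eq_iff mult.commute)
  then show "(\<lambda>z. slice_functional J C (f (embed J z))) holomorphic_on W"
    using W by (auto simp: holomorphic_on_open)
qed

section \<open>Powers dominated by a polynomial\<close>

lemma intrinsic_poly_embed:
  assumes "J \<in> unit_sphere"
  shows "intrinsic_poly p (embed J z) = embed J (\<Sum>k\<le>degree p. of_real (coeff p k) * z ^ k)"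
  by (simp add: intrinsic_poly_def linear_sum [OF bounded_linear.linear [OF bounded_linear_embed]]
      embed_mult [OF assms] embed_power [OF assms] scaleR_conv_of_real)

lemma power_le_poly:
  fixes p :: "real poly"
  assumes "p \<noteq> 0"
  obtains K where "0 \<le> K"
    "\<And>z j. j \<le> degree p \<Longrightarrow> cmod z ^ j \<le> K * (1 + cmod (\<Sum>k\<le>degree p. of_real (coeff p k) * z ^ k))"
proof -
  let ?m = "degree p" and ?c = "\<bar>lead_coeff p\<bar>"
  let ?P = "\<lambda>z :: complex. \<Sum>k\<le>?m. of_real (coeff p k) * z ^ k"
  have c: "0 < ?c" using assms by simp
  \<comment> \<open>Degree 0 is separate: its sum is empty, while the extremal lemma compares the
    terms up to index \<open>n\<close> with |z|^(n+1).\<close>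
  have low: "\<exists>M. \<forall>z. M \<le> cmod z \<longrightarrow> cmod (\<Sum>k<?m. of_real (coeff p k) * z ^ k) \<le> ?c / 2 * cmod z ^ ?m"
  proof (cases ?m)
    case 0
    then show ?thesis using c by simp
  next
    case (Suc n)
    then show ?thesis
      using polyfun_extremal_lemma [of "?c / 2" "\<lambda>k. of_real (coeff p k) :: complex" n] c
      by (simp add: lessThan_Suc_atMost)
  qed
  then obtain M where M: "\<And>z. M \<le> cmod z \<Longrightarrow> cmod (\<Sum>k<?m. of_real (coeff p k) * z ^ k) \<le> ?c / 2 * cmod z ^ ?m"
    by blast
  \<comment> \<open>The 1 comes from |z|^j \<le> 1 + |z|^m, the quotient from the region M \<le>
    |z|, where the lower terms are at most half the leading one, and the power of |M| from the
    remaining disc; \<open>M\<close> itself may be negative.\<close>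
  define K where "K = 1 + 2 / ?c + \<bar>M\<bar> ^ ?m"
  have top: "cmod z ^ ?m \<le> 2 / ?c * cmod (?P z)" if "M \<le> cmod z" for z
  proof -
    have "?P z = of_real (lead_coeff p) * z ^ ?m + (\<Sum>k<?m. of_real (coeff p k) * z ^ k)"
      by (simp add: lessThan_Suc_atMost [symmetric])
    then have "cmod (of_real (lead_coeff p) * z ^ ?m) \<le> cmod (?P z) + cmod (\<Sum>k<?m. of_real (coeff p k) * z ^ k)"
      by (metis add_diff_cancel_right' norm_triangle_ineq4)
    also have "\<dots> \<le> cmod (?P z) + ?c / 2 * cmod z ^ ?m" using M [OF that] by simp
    finally have "?c * cmod z ^ ?m \<le> 2 * cmod (?P z)" by (simp add: norm_mult norm_power)
    then show ?thesis using c by (simp add: field_simps)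
  qed
  have "cmod z ^ j \<le> K * (1 + cmod (?P z))" if j: "j \<le> ?m" for z j
  proof -
    have a: "cmod z ^ j \<le> 1 + cmod z ^ ?m"
    proof (cases "cmod z \<le> 1")
      case True
      then show ?thesis using power_le_one [of "cmod z" j] by (simp add: add_increasing2)
    next
      case False
      then have "cmod z ^ j \<le> cmod z ^ ?m" using j by (intro power_increasing) auto
      then show ?thesis by linarith
    qed
    have b: "cmod z ^ ?m \<le> 2 / ?c * cmod (?P z) + \<bar>M\<bar> ^ ?m"
    proof (cases "M \<le> cmod z")
      case True
      then show ?thesis using top [OF True] by (simp add: add_increasing2)
    next
      case False
      then have "cmod z ^ ?m \<le> \<bar>M\<bar> ^ ?m" by (intro power_mono) auto
      then show ?thesis by (simp add: add_increasing)
    qed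
    have "0 \<le> \<bar>M\<bar> ^ ?m * cmod (?P z)" "0 \<le> 2 / ?c" by simp_all
    moreover have "K * (1 + cmod (?P z)) = 1 + 2 / ?c + \<bar>M\<bar> ^ ?m + cmod (?P z) + 2 / ?c * cmod (?P z)
        + \<bar>M\<bar> ^ ?m * cmod (?P z)"
      by (simp add: K_def ring_distribs)
    ultimately show ?thesis using a b norm_ge_zero [of "?P z"] by linarith
  qed
  moreover have "0 \<le> K" by (simp add: K_def)
  ultimately show thesis using that by blast
qed

text \<open>The lower estimate is the upper one applied to \<open>inverse z\<close>.\<close>

lemma norm_embed_mult:
  assumes J: "J \<in> (unit_sphere :: 'n::{finite,linorder} clifford set)"
  obtains K where "0 < K" "\<And>z a. norm (embed J z * a) \<le> K * cmod z * norm a"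
    "\<And>z a. cmod z * norm a \<le> K * norm (embed J z * a)"
proof -
  obtain K where K: "0 < K" "\<And>a b. norm (a * b) \<le> norm a * norm (b :: 'n clifford) * K"
    using bounded_bilinear.pos_bounded [OF bounded_bilinear_times_clifford] by blast
  have 1: "norm (embed J z * a) \<le> K * cmod z * norm a" for z a
    using K(2) [of "embed J z" a] by (simp add: norm_embed [OF J] mult_ac)
  have "cmod z * norm a \<le> K * norm (embed J z * a)" for z a
  proof (cases "z = 0")
    case False
    then have "a = embed J (inverse z) * (embed J z * a)"
      by (simp add: mult.assoc [symmetric] embed_mult [OF J, symmetric])
    then have "norm a \<le> K * cmod (inverse z) * norm (embed J z * a)"
      using 1 by metis
    then show ?thesis
      using False unfolding norm_inverse by (simp add: field_simps)
  qed (use K(1) in simp)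
  with K(1) 1 show thesis by (rule that)
qed

text \<open>The weight 1/t matches the decay C/t of the resolvent; continuity is included for the
  domination criterion.\<close>

definition ray_integrable :: "'n::{finite,linorder} clifford \<Rightarrow> ('n clifford \<Rightarrow> 'n clifford) \<Rightarrow> complex \<Rightarrow> bool" where
  "ray_integrable J h u \<longleftrightarrow> continuous_on {0<..} (\<lambda>t. h (embed J (of_real t * u))) \<and>
     (\<lambda>t. norm (h (embed J (of_real t * u))) / t) integrable_on {0<..}"

lemma SH0_power_mult:
  fixes f :: "'n::{finite,linorder} clifford \<Rightarrow> 'n clifford"
  assumes J: "J \<in> unit_sphere" and \<theta>: "0 < \<theta>" "\<theta> < pi / 2" and f: "f \<in> SH0 \<theta>"
    and p: "p \<noteq> 0" and pf: "(\<lambda>s. intrinsic_poly p s * f s) \<in> SH0 \<theta>" and k: "k \<le> degree p"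
  shows "continuous_on (double_sector \<theta>) (\<lambda>z. embed J z ^ k * f (embed J z))"
    and "(\<lambda>z. slice_functional J C (embed J z ^ k * f (embed J z))) holomorphic_on double_sector \<theta>"
    and "bounded ((\<lambda>z. embed J z ^ k * f (embed J z)) ` double_sector \<theta>)"
    and "\<bar>\<psi>\<bar> < \<theta> \<Longrightarrow> \<epsilon> \<in> {1, -1} \<Longrightarrow> ray_integrable J (\<lambda>s. s ^ k * f s) (of_real \<epsilon> * cis \<psi>)"
proof -
  have dom: "(Re z, Im z) \<in> slice_domain (bisector \<theta>)" if "z \<in> double_sector \<theta>" for z
    using that \<theta> by (auto simp: slice_domain_def slice_pt_eq_embed intro: embed_in_bisector)
  have sh: "slice_hyperholomorphic (bisector \<theta>) f" using f by (simp add: SH0_def)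
  note h = slice_hyperholomorphic_holomorphic [OF sh J open_double_sector dom]
  show cont: "continuous_on (double_sector \<theta>) (\<lambda>z. embed J z ^ k * f (embed J z))"
    unfolding embed_power [OF J, symmetric]
    by (intro bounded_bilinear.continuous_on [OF bounded_bilinear_times_clifford]
        bounded_linear.continuous_on [OF bounded_linear_embed] continuous_intros h)
  show "(\<lambda>z. slice_functional J C (embed J z ^ k * f (embed J z))) holomorphic_on double_sector \<theta>"
    unfolding embed_power [OF J, symmetric] slice_functional_embed_mult [OF J]
    by (intro holomorphic_intros h)
  obtain K where K: "0 < K" "\<And>z a. norm (embed J z * a) \<le> K * cmod z * norm a"
    "\<And>z a. cmod z * norm a \<le> K * norm (embed J z * a)"
    using norm_embed_mult [OF J] by blast
  obtain L where L: "0 \<le> L"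
    "\<And>z j. j \<le> degree p \<Longrightarrow> cmod z ^ j \<le> L * (1 + cmod (\<Sum>k\<le>degree p. of_real (coeff p k) * z ^ k))"
    using power_le_poly [OF p] by blast
  let ?pf = "\<lambda>s. intrinsic_poly p s * f s"
  \<comment> \<open>\<open>L\<close> trades |z|^k for 1 + |p(z)|, and the reverse estimate in
    \<open>K\<close> turns |p(z)| |f| back into |p f|, whence the second factor
    \<open>K\<close>.\<close>
  have le: "norm (embed J z ^ k * f (embed J z)) \<le> K * L * (norm (f (embed J z)) + K * norm (?pf (embed J z)))" for z
  proof -
    let ?P = "\<Sum>k\<le>degree p. of_real (coeff p k) * z ^ k"
    have "norm (embed J z ^ k * f (embed J z)) \<le> K * (cmod z ^ k * norm (f (embed J z)))"
      using K(2) [of "z ^ k"] by (simp add: embed_power [OF J] norm_power mult.assoc)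
    also have "\<dots> \<le> K * (L * (1 + cmod ?P) * norm (f (embed J z)))"
      using K(1) by (intro mult_left_mono mult_right_mono L k) auto
    also have "\<dots> = K * L * (norm (f (embed J z)) + cmod ?P * norm (f (embed J z)))"
      by (simp add: algebra_simps)
    also have "\<dots> \<le> K * L * (norm (f (embed J z)) + K * norm (?pf (embed J z)))"
      using K L(1) unfolding intrinsic_poly_embed [OF J] by (intro mult_left_mono add_left_mono) auto
    finally show ?thesis .
  qed
  have "bounded (f ` bisector \<theta>)" "bounded (?pf ` bisector \<theta>)"
    using f pf by (simp_all add: SH0_def)
  then obtain M M' where M: "\<And>s. s \<in> bisector \<theta> \<Longrightarrow> norm (f s) \<le> M" "\<And>s. s \<in> bisector \<theta> \<Longrightarrow> norm (?pf s) \<le> M'"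
    unfolding bounded_iff by (metis imageI)
  show "bounded ((\<lambda>z. embed J z ^ k * f (embed J z)) ` double_sector \<theta>)"
    unfolding bounded_iff
  proof (intro exI ballI, elim imageE, hypsubst)
    fix z assume "z \<in> double_sector \<theta>"
    then have "embed J z \<in> bisector \<theta>" using J \<theta> by (intro embed_in_bisector)
    then show "norm (embed J z ^ k * f (embed J z)) \<le> K * L * (M + K * M')"
      using K(1) L(1) M by (intro order_trans [OF le] mult_left_mono add_mono) auto
  qed
  assume \<psi>: "\<bar>\<psi>\<bar> < \<theta>" and \<epsilon>: "\<epsilon> \<in> {1, -1}"
  let ?u = "of_real \<epsilon> * cis \<psi>"
  \<comment> \<open>\<open>SH0\<close> speaks of rays with positive radius, so the sign is absorbed
    into the angle.\<close>
  define \<psi>' where "\<psi>' = (if \<epsilon> = 1 then \<psi> else pi + \<psi>)"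
  have \<psi>': "\<psi>' \<in> angle_set \<theta>" using \<psi> by (auto simp: angle_set_def \<psi>'_def)
  have u: "t *\<^sub>R cexpJ J \<psi>' = embed J (of_real t * ?u)" for t
  proof -
    have "cis \<psi>' = ?u" using \<epsilon> by (auto simp: \<psi>'_def complex_eq_iff)
    then show ?thesis
      using linear_scale [OF bounded_linear.linear [OF bounded_linear_embed], of J t ?u]
      by (simp only: cexpJ_eq_embed scaleR_conv_of_real [where 'a = complex])
  qed
  have tan: "0 < tan \<theta>" using \<theta> by (rule tan_gt_zero)
  have in_ds: "of_real t * ?u \<in> double_sector \<theta>" if "0 < t" for t
    using mult_sign_in_double_sector [OF \<epsilon> cis_in_sector [OF \<theta>(2) \<psi> that] tan] by (simp add: mult_ac)
  have cray: "continuous_on {0<..} (\<lambda>t. embed J (of_real t * ?u) ^ k * f (embed J (of_real t * ?u)))"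
    by (rule continuous_on_compose2 [OF cont]) (auto intro!: continuous_intros in_ds)
  have int: "(\<lambda>t. norm (g (embed J (of_real t * ?u))) / t) integrable_on {0<..}" if "g \<in> SH0 \<theta>" for g
    using that J \<psi>' unfolding SH0_def u [symmetric] by (auto dest!: bspec set_lebesgue_integral_eq_integral(1))
  have "(\<lambda>t. norm (embed J (of_real t * ?u) ^ k * f (embed J (of_real t * ?u))) / t) integrable_on {0<..}"
  proof (rule integrable_on_greaterThan_dominated)
    show "continuous_on {0<..} (\<lambda>t. norm (embed J (of_real t * ?u) ^ k * f (embed J (of_real t * ?u))) / t)"
      by (intro continuous_intros cray) auto
    let ?g = "\<lambda>t. K * L * (norm (f (embed J (of_real t * ?u))) / t + K * (norm (?pf (embed J (of_real t * ?u))) / t))"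
    show "?g integrable_on {0<..}"
      by (intro integrable_on_mult_right integrable_add int f pf)
    show "norm (norm (embed J (of_real t * ?u) ^ k * f (embed J (of_real t * ?u))) / t) \<le> ?g t" if "t > 0" for t
      using divide_right_mono [OF le, of t "of_real t * ?u"] that by (simp add: add_divide_distrib [symmetric])
  qed
  with cray show "ray_integrable J (\<lambda>s. s ^ k * f s) ?u"
    by (simp add: ray_integrable_def)
qed

section \<open>Integrals of the S-resolvent along rays\<close>

text \<open>The integrand of the calculus on the ray t \<mapsto> t u: its derivative is u, and
  division by \<open>J\<close> becomes the factor \<open>- \<i>\<close>.\<close>

definition ray_op :: "('v::banach, 'n::{finite,linorder}) clifford_op \<Rightarrow> 'n clifford
    \<Rightarrow> ('n clifford \<Rightarrow> 'n clifford) \<Rightarrow> complex \<Rightarrow> real \<Rightarrow> ('v ^ ('n set)) \<Rightarrow>\<^sub>L ('v ^ ('n set))" where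
  "ray_op T J h u t = Blinfun (\<lambda>v. S_resolvent T (embed J (of_real t * u))
     (lmult (embed J (- \<i> * u) * h (embed J (of_real t * u))) v))"

text \<open>On a ray |s| = t, so |h| is comparable to |s h| / t: integrability of s h for dt/t is
  integrability of h for dt.\<close>

lemma ray_integrable_norm:
  assumes J: "J \<in> unit_sphere" and u: "cmod u = 1"
    and h: "ray_integrable J h u" "ray_integrable J (\<lambda>s. s * h s) u"
  shows "(\<lambda>t. norm (h (embed J (of_real t * u)))) integrable_on {0<..}"
proof -
  obtain K where K: "0 < K" "\<And>z a. norm (embed J z * a) \<le> K * cmod z * norm a"
     "\<And>z a. cmod z * norm a \<le> K * norm (embed J z * a)"
    by (rule norm_embed_mult [OF J]) (rule that)
  let ?h = "\<lambda>t. h (embed J (of_real t * u))"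
  show ?thesis
  proof (rule integrable_on_greaterThan_dominated)
    show "continuous_on {0<..} (\<lambda>t. norm (?h t))"
      using h(1) unfolding ray_integrable_def by (intro continuous_on_norm) simp
    show "(\<lambda>t. K * (norm (embed J (of_real t * u) * ?h t) / t)) integrable_on {0<..}"
      using h(2) unfolding ray_integrable_def by (intro integrable_on_mult_right) auto
    show "norm (norm (?h t)) \<le> K * (norm (embed J (of_real t * u) * ?h t) / t)" if "0 < t" for t
      using K(3) [of "of_real t * u" "?h t"] that u by (simp add: norm_mult field_simps)
  qed
qed

text \<open>Isolates what the ray integrals take from bisectoriality: the rays avoid the S-spectrum,
  and the resolvent decays like C/t on them. The intended \<open>U\<close> are the four directions
  of the boundary in C_J.\<close>

locale slice_rays =
  fixes T :: "('v::banach, 'n::{finite,linorder}) clifford_op" and J :: "'n clifford"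
    and U :: "complex set" and C :: real
  assumes closed_T: "T \<in> closed_ops" and J: "J \<in> unit_sphere" and C_nonneg: "0 \<le> C"
    and unit: "\<And>u. u \<in> U \<Longrightarrow> cmod u = 1"
    and resolvent: "\<And>u t. u \<in> U \<Longrightarrow> 0 < t \<Longrightarrow> embed J (of_real t * u) \<in> S_resolvent_set T"
    and bound: "\<And>u t v. u \<in> U \<Longrightarrow> 0 < t \<Longrightarrow> norm (S_resolvent T (embed J (of_real t * u)) v) \<le> C / t * norm v"
begin

sublocale L: bounded_bilinear "lmult :: 'n clifford \<Rightarrow> 'v ^ ('n set) \<Rightarrow> _"
  by (rule bounded_bilinear_lmult)

lemma right_linear: "right_linear_op T" and closed_graph: "closed {(u, x). T u = Some x}"
  using closed_T by (simp_all add: closed_ops_def)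

lemma bounded_linear_resolvent:
  "u \<in> U \<Longrightarrow> 0 < t \<Longrightarrow> bounded_linear (S_resolvent T (embed J (of_real t * u)))"
  using bounded_linear_S_resolvent(1) [OF right_linear resolvent bound] .

lemma ray_op_apply:
  assumes "u \<in> U" "0 < t"
  shows "ray_op T J h u t v = S_resolvent T (embed J (of_real t * u))
     (lmult (embed J (- \<i> * u) * h (embed J (of_real t * u))) v)"
  unfolding ray_op_def
  by (rule fun_cong [OF bounded_linear_Blinfun_apply, OF bounded_linear_compose [OF bounded_linear_resolvent [OF assms] L.bounded_linear_right]])

lemma ray_op_integrable:
  assumes u: "u \<in> U" and h: "ray_integrable J h u"
  shows "ray_op T J h u integrable_on {0<..}"
proof -
  obtain K where K: "0 < K" "\<And>z a. norm (embed J z * a) \<le> K * cmod z * norm a"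
     "\<And>z a. cmod z * norm a \<le> K * norm (embed J z * a)"
    by (rule norm_embed_mult [OF J]) (rule that)
  obtain K' where K': "0 < K'" "\<And>a v. norm (lmult a v :: 'v ^ ('n set)) \<le> norm (a :: 'n clifford) * norm v * K'"
    using L.pos_bounded by blast
  let ?h = "\<lambda>t. h (embed J (of_real t * u))"
  show ?thesis
  proof (rule integrable_on_greaterThan_dominated)
    show "continuous_on {0<..} (ray_op T J h u)"
      unfolding ray_op_def [abs_def]
    proof (rule continuous_on_S_resolvent [OF right_linear, where A = "(\<lambda>t. embed J (of_real t * u)) ` {0<..}"])
      show "continuous_on {0<..} (\<lambda>t. embed J (of_real t * u))"
        by (intro bounded_linear.continuous_on [OF bounded_linear_embed] continuous_intros)
      show "continuous_on {0<..} (\<lambda>t. embed J (- \<i> * u) * ?h t)"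
        using h unfolding ray_integrable_def
        by (intro bounded_bilinear.continuous_on [OF bounded_bilinear_times_clifford] continuous_on_const) auto
    qed (use u resolvent bound in blast)+
    \<comment> \<open>\<open>C\<close> over t bounds the resolvent, \<open>K\<close> the product
      with the unit factor \<open>embed J (- \<i> * u)\<close>, and \<open>K'\<close> the left
      multiplication on the module.\<close>
    show "(\<lambda>t. C * K * K' * (norm (?h t) / t)) integrable_on {0<..}"
      using h unfolding ray_integrable_def by (intro integrable_on_mult_right) auto
    fix t :: real assume t: "0 < t"
    have C: "0 \<le> C / t" using C_nonneg t by simp
    show "norm (ray_op T J h u t) \<le> C * K * K' * (norm (?h t) / t)"
    proof (rule norm_blinfun_bound)
      show "0 \<le> C * K * K' * (norm (?h t) / t)"
        using C K(1) K'(1) t by (simp add: zero_le_divide_iff)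
      fix v :: "'v ^ ('n set)"
      have "norm (lmult (embed J (- \<i> * u) * ?h t) v) \<le> norm (embed J (- \<i> * u) * ?h t) * norm v * K'"
        by (rule K'(2))
      also have "\<dots> \<le> (K * norm (?h t)) * norm v * K'"
        using K(2) [of "- \<i> * u" "?h t"] K'(1) unit [OF u]
        by (intro mult_right_mono) (auto simp: norm_mult)
      finally have "C / t * norm (lmult (embed J (- \<i> * u) * ?h t) v) \<le> C / t * ((K * norm (?h t)) * norm v * K')"
        using C by (rule mult_left_mono)
      with bound [OF u t] show "norm (ray_op T J h u t v) \<le> C * K * K' * (norm (?h t) / t) * norm v"
        unfolding ray_op_apply [OF u t] by (rule order_trans [THEN order_trans]) (simp add: mult_ac)
    qed
  qed
qed

text \<open>No resolvent supplies a factor 1/t here, hence the second hypothesis, on s h.\<close>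

lemma lmult_ray_integrable:
  fixes v :: "'v ^ ('n set)"
  assumes u: "u \<in> U" and h: "ray_integrable J h u" "ray_integrable J (\<lambda>s. s * h s) u"
  shows "(\<lambda>t. lmult (embed J (- \<i> * u) * h (embed J (of_real t * u))) v) integrable_on {0<..}"
proof -
  obtain K where K: "0 < K" "\<And>a v. norm (lmult a v :: 'v ^ ('n set)) \<le> norm (a :: 'n clifford) * norm v * K"
    using L.pos_bounded by blast
  let ?c = "embed J (- \<i> * u)"
  obtain K' where K': "\<And>a. norm (?c * a) \<le> norm a * K'"
    using bounded_linear.bounded [OF bounded_bilinear.bounded_linear_right [OF bounded_bilinear_times_clifford, of ?c]]
    by blast
  let ?h = "\<lambda>t. h (embed J (of_real t * u))"
  have cont: "continuous_on {0<..} ?h" using h(1) by (simp add: ray_integrable_def)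
  show ?thesis
  proof (rule integrable_on_greaterThan_dominated)
    show "continuous_on {0<..} (\<lambda>t. lmult (?c * ?h t) v)"
      by (intro L.continuous_on bounded_bilinear.continuous_on [OF bounded_bilinear_times_clifford] continuous_on_const cont)
    show "(\<lambda>t. K' * norm v * K * norm (?h t)) integrable_on {0<..}"
      by (intro integrable_on_mult_right ray_integrable_norm [OF J unit [OF u] h])
    show "norm (lmult (?c * ?h t) v) \<le> K' * norm v * K * norm (?h t)" for t
    proof -
      have "norm (lmult (?c * ?h t) v) \<le> norm (?c * ?h t) * norm v * K"
        by (rule K(2))
      also have "\<dots> \<le> (norm (?h t) * K') * norm v * K"
        using K(1) K' by (intro mult_right_mono) auto
      finally show ?thesis by (simp add: mult_ac)
    qed
  qed
qed

text \<open>By the resolvent equation the integrand paired with its image under \<open>T\<close>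
  lies in the closed graph for every t, hence so does the pair of integrals.\<close>

lemma T_ray_integral:
  assumes u: "u \<in> U" and h: "ray_integrable J h u" "ray_integrable J (\<lambda>s. s * h s) u"
  shows "T (integral {0<..} (ray_op T J h u) v)
    = Some (integral {0<..} (ray_op T J (\<lambda>s. s * h s) u) v
        - integral {0<..} (\<lambda>t. lmult (embed J (- \<i> * u) * h (embed J (of_real t * u))) v))"
proof -
  let ?G = "{(u, x). T u = Some x}"
  let ?b = "\<lambda>t. lmult (embed J (- \<i> * u) * h (embed J (of_real t * u))) v"
  let ?p = "\<lambda>t. (ray_op T J h u t v, ray_op T J (\<lambda>s. s * h s) u t v - ?b t)"
  have app: "((\<lambda>t. ray_op T J g u t v) has_integral integral {0<..} (ray_op T J g u) v) {0<..}"
    if "ray_integrable J g u" for g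
    using has_integral_linear [OF integrable_integral [OF ray_op_integrable [OF u that]] blinfun.bounded_linear_left]
    by (simp add: o_def)
  have "(?p has_integral (integral {0<..} (ray_op T J h u) v,
      integral {0<..} (ray_op T J (\<lambda>s. s * h s) u) v - integral {0<..} ?b)) {0<..}"
    by (intro has_integral_Pair has_integral_diff app h integrable_integral lmult_ray_integrable u)
  then have "((\<lambda>t. if t \<in> {0<..} then ?p t else 0) has_integral (integral {0<..} (ray_op T J h u) v,
      integral {0<..} (ray_op T J (\<lambda>s. s * h s) u) v - integral {0<..} ?b)) UNIV"
    by (simp only: has_integral_restrict_UNIV)
  moreover have "(if t \<in> {0<..} then ?p t else 0) \<in> ?G" for t
  proof (cases "0 < t")
    case True
    let ?s = "embed J (of_real t * u)"
    \<comment> \<open>Both left factors lie in the commutative C_J, so s can move past the constant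
      and meet \<open>h\<close>.\<close>
    have "?s * (embed J (- \<i> * u) * h ?s) = embed J (- \<i> * u) * (?s * h ?s)"
      by (simp only: mult.assoc [symmetric] embed_mult [OF J, symmetric]) (simp add: mult_ac)
    then have "T (ray_op T J h u t v) = Some (ray_op T J (\<lambda>s. s * h s) u t v - ?b t)"
      using S_resolvent_equation [OF right_linear J resolvent [OF u True], of "?b t"]
      by (simp only: ray_op_apply [OF u True] lmult_mult [symmetric])
    with True show ?thesis by simp
  qed (simp add: zero_prod_def right_linear_op_zero [OF right_linear])
  ultimately have "(integral {0<..} (ray_op T J h u) v,
      integral {0<..} (ray_op T J (\<lambda>s. s * h s) u) v - integral {0<..} ?b) \<in> ?G"
    by (rule has_integral_in_closed_subspace [OF _ subspace_graph [OF right_linear] closed_graph])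
  then show ?thesis by simp
qed

end

section \<open>The boundary path as four rays, and Cauchy's theorem on them\<close>

lemma embed_scaleR: "r *\<^sub>R embed J z = embed J (of_real r * z)"
  using linear_scale [OF bounded_linear.linear [OF bounded_linear_embed], of J r z]
  by (simp add: scaleR_conv_of_real [where 'a = complex])

lemma embed_minus: "embed J (- z) = - embed J z"
  by (rule linear_neg [OF bounded_linear.linear [OF bounded_linear_embed]])

lemma embed_ii: "embed J \<i> = J"
  by (simp add: embed_def)

lemma path_bisector_eq_embed:
  "0 < t \<Longrightarrow> path_bisector \<phi> J \<epsilon> t = embed J (of_real t * (of_real \<epsilon> * cis (- \<phi>)))"
  "0 < t \<Longrightarrow> path_bisector \<phi> J \<epsilon> (- t) = embed J (of_real t * (of_real \<epsilon> * cis \<phi>))"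
  by (simp_all add: path_bisector_def cexpJ_eq_embed embed_scaleR mult_ac)

lemma vector_derivative_path_bisector:
  assumes t: "0 < t"
  shows "vector_derivative (path_bisector \<phi> J \<epsilon>) (at t) = embed J (of_real \<epsilon> * cis (- \<phi>))"
    and "vector_derivative (path_bisector \<phi> J \<epsilon>) (at (- t)) = - embed J (of_real \<epsilon> * cis \<phi>)"
proof -
  let ?u = "embed J (of_real \<epsilon> * cis (- \<phi>))"
  have "((\<lambda>s. s *\<^sub>R ?u) has_vector_derivative ?u) (at t)"
    by (auto intro!: derivative_eq_intros)
  then have "(path_bisector \<phi> J \<epsilon> has_vector_derivative ?u) (at t)"
    by (rule has_vector_derivative_transform_within_open [of _ _ _ "{0<..}"])
      (use t in \<open>auto simp: path_bisector_eq_embed embed_scaleR\<close>)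
  then show "vector_derivative (path_bisector \<phi> J \<epsilon>) (at t) = ?u"
    by (rule vector_derivative_at)
  let ?w = "embed J (of_real \<epsilon> * cis \<phi>)"
  have "((\<lambda>s. s *\<^sub>R (- ?w)) has_vector_derivative - ?w) (at (- t))"
    by (auto intro!: derivative_eq_intros)
  then have "(path_bisector \<phi> J \<epsilon> has_vector_derivative - ?w) (at (- t))"
  proof (rule has_vector_derivative_transform_within_open [of _ _ _ "{..<0}"])
    fix s :: real assume "s \<in> {..<0}"
    then show "s *\<^sub>R (- ?w) = path_bisector \<phi> J \<epsilon> s"
      using path_bisector_eq_embed(2) [of "- s" \<phi> J \<epsilon>] embed_scaleR [of "- s" J "of_real \<epsilon> * cis \<phi>"] by simp
  qed (use t in auto)
  then show "vector_derivative (path_bisector \<phi> J \<epsilon>) (at (- t)) = - ?w"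
    by (rule vector_derivative_at)
qed

text \<open>Up to the sign \<open>\<epsilon>\<close>, the path leaves 0 at angle -\<phi> for t > 0
  and comes in from infinity at angle \<phi> for t < 0; the reversed direction is the minus
  sign.\<close>

lemma (in slice_rays) path_integral_eq:
  assumes U: "of_real \<epsilon> * cis (- \<phi>) \<in> U" "of_real \<epsilon> * cis \<phi> \<in> U"
    and h: "ray_integrable J h (of_real \<epsilon> * cis (- \<phi>))" "ray_integrable J h (of_real \<epsilon> * cis \<phi>)"
  shows "integral UNIV (\<lambda>t. Blinfun (\<lambda>v. S_resolvent T (path_bisector \<phi> J \<epsilon> t)
       (lmult (vector_derivative (path_bisector \<phi> J \<epsilon>) (at t) * (- J) * h (path_bisector \<phi> J \<epsilon> t)) v)))
    = integral {0<..} (ray_op T J h (of_real \<epsilon> * cis (- \<phi>))) - integral {0<..} (ray_op T J h (of_real \<epsilon> * cis \<phi>))"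
    (is "integral UNIV ?F = integral _ (ray_op _ _ _ ?u) - integral _ (ray_op _ _ _ ?w)")
proof -
  have F1: "?F t = ray_op T J h ?u t" if "t \<in> {0<..}" for t
  proof -
    have "embed J ?u * (- J) = embed J (- \<i> * ?u)"
      using embed_mult [OF J, of ?u "- \<i>"] by (simp add: embed_minus embed_ii mult.commute)
    then show ?thesis
      using that by (simp only: ray_op_def vector_derivative_path_bisector path_bisector_eq_embed greaterThan_iff)
  qed
  have 1: "(?F has_integral integral {0<..} (ray_op T J h ?u)) {0<..}"
    by (rule has_integral_eq [OF F1 [symmetric] integrable_integral [OF ray_op_integrable [OF U(1) h(1)]]])
  have F2: "?F (- t) = - ray_op T J h ?w t" if "t \<in> {0<..}" for t
  proof -
    have t: "0 < t" using that by simp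
    have a: "- embed J ?w * (- J) = - embed J (- \<i> * ?w)"
      using embed_mult [OF J, of ?w "\<i>"] by (simp add: embed_minus embed_ii mult.commute)
    let ?S = "S_resolvent T (embed J (of_real t * ?w))"
    let ?a = "embed J (- \<i> * ?w) * h (embed J (of_real t * ?w))"
    have bl: "bounded_linear (\<lambda>v. ?S (lmult ?a v))"
      by (rule bounded_linear_compose [OF bounded_linear_resolvent [OF U(2) t] L.bounded_linear_right])
    have "?F (- t) = Blinfun (\<lambda>v. - ?S (lmult ?a v))"
      unfolding path_bisector_eq_embed(2) [OF t] vector_derivative_path_bisector(2) [OF t] a
      using linear_neg [OF bounded_linear.linear [OF bounded_linear_resolvent [OF U(2) t]]]
      by (simp add: L.minus_left)
    also have "\<dots> = - ray_op T J h ?w t"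
      unfolding ray_op_def
      by (rule blinfun_eqI) (simp only: bounded_linear_Blinfun_apply [OF bl] blinfun.minus_left
          bounded_linear_Blinfun_apply [OF bounded_linear_minus [OF bl]])
    finally show ?thesis .
  qed
  have "((\<lambda>t. ?F (- t)) has_integral - integral {0<..} (ray_op T J h ?w)) {0<..}"
    by (rule has_integral_eq [OF F2 [symmetric] has_integral_neg [OF integrable_integral [OF ray_op_integrable [OF U(2) h(2)]]]])
  from has_integral_split_zero [OF 1 this] show ?thesis
    by (simp add: integral_unique)
qed

text \<open>Each coordinate of the integrand is the real part of
  \<open>cis \<psi> * G (of_real t * cis \<psi>)\<close> for a scalar holomorphic \<open>G\<close>,
  so the theorem for the sector applies coordinate by coordinate.\<close>

lemma lmult_ray_integrals_eq:
  fixes v :: "'v::banach ^ ('n::{finite,linorder} set)"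
  assumes J: "J \<in> (unit_sphere :: 'n clifford set)" and \<phi>: "0 < \<phi>" "\<phi> < \<theta>" "\<theta> < pi / 2"
    and \<epsilon>: "\<epsilon> \<in> {1, -1}"
    and hol: "\<And>A. (\<lambda>z. slice_functional J A (h (embed J z))) holomorphic_on double_sector \<theta>"
    and bd: "bounded ((\<lambda>z. h (embed J z)) ` double_sector \<theta>)"
    and bd1: "bounded ((\<lambda>z. embed J z * h (embed J z)) ` double_sector \<theta>)"
    and int: "\<And>\<psi>. \<bar>\<psi>\<bar> \<le> \<phi> \<Longrightarrow> (\<lambda>t. norm (h (embed J (of_real t * (of_real \<epsilon> * cis \<psi>))))) integrable_on {0<..}"
  shows "integral {0<..} (\<lambda>t. lmult (embed J (- \<i> * (of_real \<epsilon> * cis \<phi>)) * h (embed J (of_real t * (of_real \<epsilon> * cis \<phi>)))) v)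
    = integral {0<..} (\<lambda>t. lmult (embed J (- \<i> * (of_real \<epsilon> * cis (- \<phi>))) * h (embed J (of_real t * (of_real \<epsilon> * cis (- \<phi>))))) v)"
proof -
  let ?u = "\<lambda>\<psi>. of_real \<epsilon> * cis \<psi>"
  let ?b = "\<lambda>\<psi> t. embed J (- \<i> * ?u \<psi>) * h (embed J (of_real t * ?u \<psi>))"
  have tan: "0 < tan \<theta>" using \<phi> by (intro tan_gt_zero) auto
  have "\<exists>I. \<forall>\<psi>\<in>{\<phi>, - \<phi>}. ((\<lambda>t. coords (?b \<psi> t) $ A) has_integral I) {0<..}" for A
  proof -
    let ?\<Lambda> = "slice_functional J A"
    \<comment> \<open>\<open>\<epsilon>\<close> maps the right sector to the half of the double
      sector in question; \<open>- \<i> * of_real \<epsilon>\<close> is what remains of the constant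
      in the integrand once \<open>cis \<psi>\<close> is split off as dz/dt.\<close>
    define G where "G z = - \<i> * of_real \<epsilon> * ?\<Lambda> (h (embed J (of_real \<epsilon> * z)))" for z
    obtain B where B: "0 < B" "\<And>x. norm (?\<Lambda> x) \<le> norm x * B"
      using bounded_linear.pos_bounded [OF bounded_linear_slice_functional [of J A]] by blast
    obtain M where M: "\<And>z. z \<in> double_sector \<theta> \<Longrightarrow> norm (h (embed J z)) \<le> M"
      using bd by (auto simp: bounded_iff)
    obtain M' where M': "\<And>z. z \<in> double_sector \<theta> \<Longrightarrow> norm (embed J z * h (embed J z)) \<le> M'"
      using bd1 by (auto simp: bounded_iff)
    have "G holomorphic_on sector \<theta>"
    proof -
      have "(\<lambda>z. of_real \<epsilon> * z) ` sector \<theta> \<subseteq> double_sector \<theta>"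
        using mult_sign_in_double_sector [OF \<epsilon> _ tan] by blast
      moreover have "(\<lambda>z. of_real \<epsilon> * z) holomorphic_on sector \<theta>"
        by (intro holomorphic_intros)
      ultimately have "(?\<Lambda> \<circ> (\<lambda>z. h (embed J z))) \<circ> (\<lambda>z. of_real \<epsilon> * z) holomorphic_on sector \<theta>"
        using hol [of A] by (intro holomorphic_on_compose_gen) (auto simp: o_def)
      then show ?thesis
        unfolding G_def [abs_def] by (intro holomorphic_on_mult holomorphic_on_const) (simp add: o_def)
    qed
    note contG = holomorphic_on_imp_continuous_on [OF this]
    have ray: "of_real \<epsilon> * (of_real t * cis \<psi>) \<in> double_sector \<theta>" "of_real t * cis \<psi> \<in> sector \<theta>"
      if "0 < t" "\<bar>\<psi>\<bar> \<le> \<phi>" for t \<psi>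
      using cis_in_sector [of \<theta> \<psi> t] mult_sign_in_double_sector [OF \<epsilon> _ tan] that \<phi> by simp_all
    have nG: "norm (G z) = norm (?\<Lambda> (h (embed J (of_real \<epsilon> * z))))" for z
      using \<epsilon> by (auto simp: G_def norm_mult)
    have intG: "(\<lambda>t. norm (G (of_real t * cis \<psi>))) integrable_on {0<..}" if "\<bar>\<psi>\<bar> \<le> \<phi>" for \<psi>
    proof (rule integrable_on_greaterThan_dominated)
      show "continuous_on {0<..} (\<lambda>t. norm (G (of_real t * cis \<psi>)))"
        by (intro continuous_on_norm continuous_on_compose2 [OF contG] continuous_intros) (auto intro: ray that)
      show "(\<lambda>t. norm (h (embed J (of_real t * ?u \<psi>))) * B) integrable_on {0<..}"
        by (intro integrable_on_mult_left int that)
      show "norm (norm (G (of_real t * cis \<psi>))) \<le> norm (h (embed J (of_real t * ?u \<psi>))) * B" for t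
        using B(2) [of "h (embed J (of_real t * ?u \<psi>))"] by (simp add: nG mult_ac)
    qed
    have int': "(\<lambda>t. cis \<psi> * G (of_real t * cis \<psi>)) integrable_on {0<..}" if "\<bar>\<psi>\<bar> \<le> \<phi>" for \<psi>
    proof (rule integrable_on_greaterThan_dominated [OF _ intG [OF that]])
      show "continuous_on {0<..} (\<lambda>t. cis \<psi> * G (of_real t * cis \<psi>))"
        by (intro continuous_on_mult continuous_on_compose2 [OF contG] continuous_intros) (auto intro: ray that)
    qed (simp add: norm_mult)
    have eq: "integral {0<..} (\<lambda>t. cis \<phi> * G (of_real t * cis \<phi>)) = integral {0<..} (\<lambda>t. cis (- \<phi>) * G (of_real t * cis (- \<phi>)))"
    proof (rule sector_ray_integrals_eq [OF \<open>G holomorphic_on sector \<theta>\<close> \<phi> _ _ intG])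
      fix t \<psi> :: real assume t: "0 < t" "\<bar>\<psi>\<bar> \<le> \<phi>"
      let ?z = "of_real \<epsilon> * (of_real t * cis \<psi>)"
      show "norm (G (of_real t * cis \<psi>)) \<le> max (M * B) (M' * B)"
        unfolding nG using mult_right_mono [OF M [OF ray(1) [OF t]] less_imp_le [OF B(1)]]
        by (intro order_trans [OF B(2)] max.coboundedI1)
      have "norm ?z = t" using \<epsilon> t by (auto simp: norm_mult)
      then have "t * norm (G (of_real t * cis \<psi>)) = norm (?\<Lambda> (embed J ?z * h (embed J ?z)))"
        by (simp only: nG slice_functional_embed_mult [OF J] norm_mult)
      also have "\<dots> \<le> max (M * B) (M' * B)"
        using mult_right_mono [OF M' [OF ray(1) [OF t]] less_imp_le [OF B(1)]]
        by (intro order_trans [OF B(2)] max.coboundedI2)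
      finally show "t * norm (G (of_real t * cis \<psi>)) \<le> max (M * B) (M' * B)" .
    qed
    have co: "Re (cis \<psi> * G (of_real t * cis \<psi>)) = coords (?b \<psi> t) $ A" for \<psi> t
    proof -
      have "cis \<psi> * G (of_real t * cis \<psi>) = (- \<i> * ?u \<psi>) * ?\<Lambda> (h (embed J (of_real t * ?u \<psi>)))"
        by (simp add: G_def mult_ac)
      also have "\<dots> = ?\<Lambda> (?b \<psi> t)"
        by (rule slice_functional_embed_mult [OF J, symmetric])
      finally show ?thesis by (simp add: slice_functional_def)
    qed
    have hi: "((\<lambda>t. coords (?b \<psi> t) $ A) has_integral Re (integral {0<..} (\<lambda>t. cis \<psi> * G (of_real t * cis \<psi>)))) {0<..}"
      if "\<bar>\<psi>\<bar> \<le> \<phi>" for \<psi>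
      using has_integral_linear [OF integrable_integral [OF int' [OF that]] bounded_linear_Re]
      by (simp only: o_def co)
    show ?thesis
    proof (intro exI ballI)
      fix \<psi> assume \<psi>: "\<psi> \<in> {\<phi>, - \<phi>}"
      then have "integral {0<..} (\<lambda>t. cis \<psi> * G (of_real t * cis \<psi>)) = integral {0<..} (\<lambda>t. cis \<phi> * G (of_real t * cis \<phi>))"
        using eq by (metis insertE singletonD)
      moreover have "\<bar>\<psi>\<bar> \<le> \<phi>" using \<psi> \<phi> by auto
      ultimately show "((\<lambda>t. coords (?b \<psi> t) $ A) has_integral Re (integral {0<..} (\<lambda>t. cis \<phi> * G (of_real t * cis \<phi>)))) {0<..}"
        using hi [of \<psi>] by (simp only:)
    qed
  qed
  then obtain I where I: "\<And>A \<psi>. \<psi> \<in> {\<phi>, - \<phi>} \<Longrightarrow> ((\<lambda>t. coords (?b \<psi> t) $ A) has_integral I A) {0<..}"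
    by metis
  have "((\<lambda>t. lmult (?b \<psi> t) v) has_integral (\<Sum>A\<in>UNIV. I A *\<^sub>R lmult (of_coords (axis A 1)) v)) {0<..}"
    if "\<psi> \<in> {\<phi>, - \<phi>}" for \<psi>
    by (subst lmult_eq_sum) (intro has_integral_sum has_integral_scaleR_left I that finite)
  then have "integral {0<..} (\<lambda>t. lmult (?b \<psi> t) v) = (\<Sum>A\<in>UNIV. I A *\<^sub>R lmult (of_coords (axis A 1)) v)"
    if "\<psi> \<in> {\<phi>, - \<phi>}" for \<psi>
    using that by (intro integral_unique)
  from this [of \<phi>] this [of "- \<phi>"] show ?thesis by simp
qed

text \<open>On these rays |Im s| = tan(\<phi>) |Re s|, too large for the closure of
  \<open>bisector \<omega>\<close> and not strictly small enough for \<open>bisector \<phi>\<close>.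
  So the resolvent estimate at angle \<phi> is available on the boundary itself.\<close>

lemma bisectorial_slice_rays:
  assumes T: "bisectorial \<omega> T" and \<omega>: "0 < \<omega>" "\<omega> < \<phi>" "\<phi> < pi / 2" and J: "J \<in> unit_sphere"
  obtains C where "slice_rays T J {of_real \<epsilon> * cis \<psi> | \<epsilon> \<psi>. \<epsilon> \<in> {1, -1} \<and> \<psi> \<in> {\<phi>, - \<phi>}} C"
proof -
  let ?U = "{of_real \<epsilon> * cis \<psi> | \<epsilon> \<psi>. \<epsilon> \<in> {1 :: real, -1} \<and> \<psi> \<in> {\<phi>, - \<phi>}}"
  obtain C where C: "0 \<le> C" "\<And>s v. s \<in> paravectors - (bisector \<phi> \<union> {0}) \<Longrightarrow> norm (S_resolvent T s v) \<le> C / norm s * norm v"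
    using T \<omega> unfolding bisectorial_def by (metis greaterThanLessThan_iff)
  have cos: "0 < cos \<phi>" using \<omega> by (intro cos_gt_zero_pi) auto
  have sin: "0 < sin \<phi>" using \<omega> by (intro sin_gt_zero) auto
  have tan: "tan \<omega> < tan \<phi>" using \<omega> by (intro tan_monotone) auto
  have tc: "tan \<phi> * cos \<phi> = sin \<phi>" using cos by (simp add: tan_def)
  have part: "norm (embed J (of_real t * u) - of_real (real_part (embed J (of_real t * u)))) = t * sin \<phi>"
      "\<bar>real_part (embed J (of_real t * u))\<bar> = t * cos \<phi>"
      "norm (embed J (of_real t * u)) = t" if "u \<in> ?U" "0 < t" for u t
  proof -
    have "\<bar>Re u\<bar> = cos \<phi>" "\<bar>Im u\<bar> = sin \<phi>" "cmod u = 1"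
      using that(1) cos sin by (auto simp: norm_mult)
    then show "norm (embed J (of_real t * u) - of_real (real_part (embed J (of_real t * u)))) = t * sin \<phi>"
      "\<bar>real_part (embed J (of_real t * u))\<bar> = t * cos \<phi>" "norm (embed J (of_real t * u)) = t"
      using J \<open>0 < t\<close> by (simp_all add: real_part_embed norm_embed norm_mult abs_mult) (simp add: embed_def unit_sphere_def abs_mult)
  qed
  show thesis
  proof (rule that [of C], unfold_locales)
    fix u t v assume u: "u \<in> ?U" and t: "0 < (t :: real)"
    let ?s = "embed J (of_real t * u)"
    have "tan \<omega> * (t * cos \<phi>) < tan \<phi> * (t * cos \<phi>)"
      using tan t cos by (intro mult_strict_right_mono) auto
    also have "\<dots> = t * sin \<phi>" using tc by (simp add: mult.left_commute)
    finally have "?s \<notin> closure (bisector \<omega>)"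
      using closure_bisector_imag_le [of \<omega> ?s] part [OF u t] \<omega> by auto
    then show "?s \<in> S_resolvent_set T"
      using T embed_in_paravectors [OF J] unfolding bisectorial_def S_spectrum_def by blast
    have "?s \<notin> bisector \<phi>"
      using bisector_imag_less [OF \<omega>(3), of ?s] part [OF u t] tc by (auto simp: mult.left_commute)
    moreover have "?s \<noteq> 0" using part(3) [OF u t] t by auto
    ultimately show "norm (S_resolvent T ?s v) \<le> C / t * norm v"
      using C(2) [of ?s v] embed_in_paravectors [OF J] part(3) [OF u t] by auto
  qed (use T J C(1) in \<open>auto simp: bisectorial_def norm_mult\<close>)
qed

theorem proposition3p15:
  fixes T :: "('v::banach, 'n::{finite,linorder}) clifford_op"
    and f :: "'n clifford \<Rightarrow> 'n clifford"
    and p :: "real poly" and m :: nat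
    and \<omega> \<theta> \<phi> :: real and J :: "'n clifford"
  assumes "T \<in> closed_ops"
    and "\<omega> \<in> {0<..<pi / 2}"
    and "bisectorial \<omega> T"
    and "\<theta> \<in> {\<omega><..<pi / 2}"
    and "f \<in> SH0 \<theta>"
    and "p \<noteq> 0" and "degree p = m"
    and "(\<lambda>s. intrinsic_poly p s * f s) \<in> SH0 \<theta>"
    and "\<phi> \<in> {\<omega><..<\<theta>}" and "J \<in> unit_sphere"
  shows "range (blinfun_apply (omega_calculus T \<phi> J f)) \<subseteq> dom (op_power T m) \<and>
    (\<lambda>v. Some (omega_calculus T \<phi> J (\<lambda>s. intrinsic_poly p s * f s) v))
      = op_poly p T \<circ>\<^sub>m (\<lambda>v. Some (omega_calculus T \<phi> J f v))"
proof -
  let ?pf = "\<lambda>s. intrinsic_poly p s * f s"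
  define U where "U = {of_real \<epsilon> * cis \<psi> | \<epsilon> \<psi>. \<epsilon> \<in> {1 :: real, -1} \<and> \<psi> \<in> {\<phi>, - \<phi>}}"
  have ang: "0 < \<phi>" "\<phi> < \<theta>" "\<theta> < pi / 2" "0 < \<theta>" "0 < \<omega>" "\<omega> < \<phi>" "\<phi> < pi / 2"
    using assms by auto
  obtain C where "slice_rays T J U C"
    using bisectorial_slice_rays [OF \<open>bisectorial \<omega> T\<close> ang(5-7) \<open>J \<in> unit_sphere\<close>] unfolding U_def by blast
  then interpret slice_rays T J U C .
  define h where "h k s = s ^ k * f s" for k s
  have h_Suc: "(\<lambda>s. s * h k s) = h (Suc k)" for k
    by (simp add: h_def fun_eq_iff mult.assoc)
  note hk = SH0_power_mult [OF J ang(4,3) \<open>f \<in> SH0 \<theta>\<close> \<open>p \<noteq> 0\<close> \<open>?pf \<in> SH0 \<theta>\<close>, unfolded \<open>degree p = m\<close>]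
  have in_U: "of_real \<epsilon> * cis \<psi> \<in> U" if "\<epsilon> \<in> {1, -1}" "\<psi> \<in> {\<phi>, - \<phi>}" for \<epsilon> \<psi>
    using that unfolding U_def by blast
  have ray_h: "ray_integrable J (h k) (of_real \<epsilon> * cis \<psi>)" if "k \<le> m" "\<epsilon> \<in> {1, -1}" "\<bar>\<psi>\<bar> \<le> \<phi>" for k \<epsilon> \<psi>
    using hk(4) [OF that(1) _ that(2), of \<psi>] that(3) ang unfolding h_def [abs_def] by simp
  \<comment> \<open>The case of the constant polynomial 1 and the power 0, with p f in place of
    f.\<close>
  have ray_pf: "ray_integrable J ?pf (of_real \<epsilon> * cis \<psi>)" if "\<epsilon> \<in> {1, -1}" "\<bar>\<psi>\<bar> \<le> \<phi>" for \<epsilon> \<psi>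
    using SH0_power_mult(4) [OF J ang(4,3) \<open>?pf \<in> SH0 \<theta>\<close>, of 1 0 \<psi> \<epsilon>] \<open>?pf \<in> SH0 \<theta>\<close> that ang
    by (simp add: intrinsic_poly_def)
  define I where "I k \<epsilon> = integral {0<..} (ray_op T J (h k) (of_real \<epsilon> * cis (- \<phi>)))
      - integral {0<..} (ray_op T J (h k) (of_real \<epsilon> * cis \<phi>))" for k \<epsilon>
  \<comment> \<open>The calculus at s^k f, expressed through ray integrals.\<close>
  define Om where "Om k = (1 / (2 * pi)) *\<^sub>R (\<Sum>\<epsilon>\<in>{1, -1}. I k \<epsilon>)" for k
  have TI: "T (I k \<epsilon> v) = Some (I (Suc k) \<epsilon> v)" if k: "k < m" and \<epsilon>: "\<epsilon> \<in> {1, -1}" for k \<epsilon> v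
  proof -
    let ?b = "\<lambda>\<psi>. integral {0<..} (\<lambda>t. lmult (embed J (- \<i> * (of_real \<epsilon> * cis \<psi>)) * h k (embed J (of_real t * (of_real \<epsilon> * cis \<psi>)))) v)"
    have T\<psi>: "T (integral {0<..} (ray_op T J (h k) (of_real \<epsilon> * cis \<psi>)) v)
        = Some (integral {0<..} (ray_op T J (h (Suc k)) (of_real \<epsilon> * cis \<psi>)) v - ?b \<psi>)"
      if "\<psi> \<in> {\<phi>, - \<phi>}" for \<psi>
      using T_ray_integral [OF in_U [OF \<epsilon> that], of "h k" v] ray_h [OF _ \<epsilon>, of k \<psi>] ray_h [OF _ \<epsilon>, of "Suc k" \<psi>] that k ang
      unfolding h_Suc by auto
    \<comment> \<open>The two rays leave the same boundary term, which cancels in the difference.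
      Since k < m, the product s^(k+1) f is still bounded, as the large arcs require.\<close>
    have "?b \<phi> = ?b (- \<phi>)"
    proof (rule lmult_ray_integrals_eq [OF J ang(1-3) \<epsilon>])
      show "(\<lambda>z. slice_functional J A (h k (embed J z))) holomorphic_on double_sector \<theta>" for A
        using hk(2) [of k A] k by (simp add: h_def)
      show "bounded ((\<lambda>z. h k (embed J z)) ` double_sector \<theta>)"
        using hk(3) [of k] k by (simp add: h_def)
      show "bounded ((\<lambda>z. embed J z * h k (embed J z)) ` double_sector \<theta>)"
        using hk(3) [of "Suc k"] k by (simp add: h_def mult.assoc)
      fix \<psi> :: real assume "\<bar>\<psi>\<bar> \<le> \<phi>"
      show "(\<lambda>t. norm (h k (embed J (of_real t * (of_real \<epsilon> * cis \<psi>))))) integrable_on {0<..}"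
        using ray_integrable_norm [OF J, of "of_real \<epsilon> * cis \<psi>" "h k"] ray_h [of k \<epsilon> \<psi>] ray_h [of "Suc k" \<epsilon> \<psi>]
          \<epsilon> k \<open>\<bar>\<psi>\<bar> \<le> \<phi>\<close> unfolding h_Suc by (auto simp: norm_mult)
    qed
    then show ?thesis
      using right_linear_op_diff [OF right_linear T\<psi> T\<psi>, of "- \<phi>" \<phi>]
      by (simp add: I_def blinfun.diff_left)
  qed
  have T_Om: "T (Om k v) = Some (Om (Suc k) v)" if "k < m" for k v
    using right_linear_op_scaleR [OF right_linear right_linear_op_add [OF right_linear TI TI], OF that _ that, of 1 "-1" "1 / (2 * pi)" v v]
    by (simp add: Om_def blinfun.scaleR_left blinfun.add_left)
  \<comment> \<open>Membership in the domain and the value are obtained together; the induction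
    reaches exactly k = m.\<close>
  have pow: "op_power T k (Om 0 v) = Some (Om k v)" if "k \<le> m" for k v
    using that by (induction k) (simp_all add: T_Om)
  have calc: "omega_calculus T \<phi> J g = (1 / (2 * pi)) *\<^sub>R (\<Sum>\<epsilon>\<in>{1, -1}.
      integral {0<..} (ray_op T J g (of_real \<epsilon> * cis (- \<phi>))) - integral {0<..} (ray_op T J g (of_real \<epsilon> * cis \<phi>)))"
    if "\<And>\<epsilon> \<psi>. \<epsilon> \<in> {1, -1} \<Longrightarrow> \<bar>\<psi>\<bar> \<le> \<phi> \<Longrightarrow> ray_integrable J g (of_real \<epsilon> * cis \<psi>)" for g
    unfolding omega_calculus_def
    by (intro arg_cong [where f = "scaleR _"] sum.cong refl path_integral_eq in_U that) (use ang in auto)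
  have calc_f: "omega_calculus T \<phi> J f = Om 0"
  proof -
    have "h 0 = f" by (simp add: h_def fun_eq_iff)
    then show ?thesis
      unfolding Om_def I_def using ray_h [of 0] by (subst calc) auto
  qed
  \<comment> \<open>Linearity splits p f into monomials, each of which is integrable by
    \<open>ray_h\<close>.\<close>
  have int_pf: "integral {0<..} (ray_op T J ?pf u) = (\<Sum>k\<le>m. coeff p k *\<^sub>R integral {0<..} (ray_op T J (h k) u))"
    if u: "u = of_real \<epsilon> * cis \<psi>" "\<epsilon> \<in> {1, -1}" "\<psi> \<in> {\<phi>, - \<phi>}" for u \<epsilon> \<psi>
  proof -
    have uU: "u \<in> U" using u in_U by blast
    have "((\<lambda>t. \<Sum>k\<le>m. coeff p k *\<^sub>R ray_op T J (h k) u t) has_integral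
        (\<Sum>k\<le>m. coeff p k *\<^sub>R integral {0<..} (ray_op T J (h k) u))) {0<..}"
      using u ang
      by (intro has_integral_sum has_integral_cmul integrable_integral ray_op_integrable uU) (auto intro: ray_h)
    moreover have eq: "(\<Sum>k\<le>m. coeff p k *\<^sub>R ray_op T J (h k) u t) = ray_op T J ?pf u t" if "t \<in> {0<..}" for t
    proof (rule blinfun_eqI)
      fix v
      have t: "0 < t" using that by simp
      let ?s = "embed J (of_real t * u)"
      let ?F = "\<lambda>a. S_resolvent T ?s (lmult (embed J (- \<i> * u) * a) v)"
      have lin: "linear ?F"
        by (intro bounded_linear.linear bounded_linear_compose [OF bounded_linear_resolvent [OF uU t]]
          bounded_linear_compose [OF L.bounded_linear_left]
          bounded_bilinear.bounded_linear_right [OF bounded_bilinear_times_clifford])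
      have "?F (?pf ?s) = ?F (\<Sum>k\<le>m. coeff p k *\<^sub>R h k ?s)"
        by (simp add: intrinsic_poly_def h_def sum_distrib_right \<open>degree p = m\<close>)
      also have "\<dots> = (\<Sum>k\<le>m. coeff p k *\<^sub>R ?F (h k ?s))"
        by (simp only: linear_sum [OF lin] linear_scale [OF lin])
      finally show "(\<Sum>k\<le>m. coeff p k *\<^sub>R ray_op T J (h k) u t) v = ray_op T J ?pf u t v"
        by (simp only: ray_op_apply [OF uU t] blinfun.sum_left blinfun.scaleR_left)
    qed
    ultimately show ?thesis
      by (intro integral_unique has_integral_eq [OF eq])
  qed
  have calc_pf: "omega_calculus T \<phi> J ?pf = (\<Sum>k\<le>m. coeff p k *\<^sub>R Om k)"
  proof -
    have "omega_calculus T \<phi> J ?pf = (1 / (2 * pi)) *\<^sub>R (\<Sum>\<epsilon>\<in>{1, -1}. \<Sum>k\<le>m. coeff p k *\<^sub>R I k \<epsilon>)"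
      unfolding I_def
      by (rule trans [OF calc], rule ray_pf, assumption, assumption)
        (intro arg_cong [where f = "scaleR _"] sum.cong refl,
         simp add: int_pf [OF refl] sum_subtractf scaleR_diff_right)
    also have "\<dots> = (\<Sum>k\<le>m. coeff p k *\<^sub>R Om k)"
      by (subst sum.swap) (simp add: Om_def scaleR_sum_right scaleR_add_right sum.distrib mult.commute)
    finally show ?thesis .
  qed
  \<comment> \<open>The domain test in \<open>op_poly\<close> concerns T^m and succeeds by
    \<open>pow\<close>, which also identifies every \<open>the\<close>.\<close>
  have "op_poly p T (Om 0 v) = Some (\<Sum>k\<le>m. coeff p k *\<^sub>R Om k v)" for v
    using pow by (auto simp: op_poly_def \<open>degree p = m\<close> intro!: sum.cong)
  moreover have "range (Om 0) \<subseteq> dom (op_power T m)"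
    using pow [of m] by auto
  ultimately show ?thesis
    unfolding calc_f calc_pf by (auto simp: fun_eq_iff blinfun.sum_left blinfun.scaleR_left)
qed

end
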